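(* Let $\nu$ be a probability measure on $\mathbb{R}$ which is purely absolutely continuous with a bounded and compactly supported density $r$, i.e. $d\nu(E) = r(E)\,dE$. Let $\Omega = (\mathrm{supp}\,\nu)^{\mathbb{Z}}$, $\mu = \nu^{\mathbb{Z}}$, and for $\omega\in\Omega$ let $H_\omega$ be the operator in $\ell^2(\mathbb{Z})$ given by $[H_\omega\psi](n) = \psi(n+1)+\psi(n-1)+\omega_n\psi(n)$. Then there are $C,\gamma\in(0,\infty)$ such that for all $m,n\in\mathbb{Z}$, $$\int_\Omega\left(\sup_{t\in\mathbb{R}}\left|\left\langle\delta_m,e^{-itH_\omega}\delta_n\right\rangle\right|\right)d\mu(\omega)\le Ce^{-\gamma|m-n|}.$$
   Context: $\{\delta_n\}_{n\in\mathbb{Z}}$ denotes the standard orthonormal basis of $\ell^2(\mathbb{Z})$. Since $\mathrm{supp}\,\nu$ is compact, each $H_\omega$ is a bounded self-adjoint operator. *)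

theory Defs
  imports "HOL-Analysis.Analysis" "HOL-Probability.Probability"
begin

section \<open>The Hilbert space of square-summable complex sequences indexed by the integers\<close>

typedef ell2 = "{f :: int \<Rightarrow> complex. (\<lambda>n. (cmod (f n))\<^sup>2) summable_on UNIV}"
  morphisms coord Abs_ell2
  by (rule exI[of _ "\<lambda>_. 0"]) simp

setup_lifting type_definition_ell2

lemma ell2_eqI: "(\<And>n. coord f n = coord g n) \<Longrightarrow> f = g"
  by (simp add: coord_inject[symmetric] fun_eq_iff)

lemma coord_summable: "(\<lambda>n. (cmod (coord f n))\<^sup>2) summable_on UNIV"
  using coord[of f] by simp

lemma cmod_add_square_le: "(cmod (a + b))\<^sup>2 \<le> 2 * (cmod a)\<^sup>2 + 2 * (cmod b)\<^sup>2"
proof -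
  have "(cmod (a + b))\<^sup>2 \<le> (cmod a + cmod b)\<^sup>2"
    by (intro power_mono norm_triangle_ineq) simp
  also have "\<dots> \<le> 2 * (cmod a)\<^sup>2 + 2 * (cmod b)\<^sup>2"
    using sum_squares_bound[of "cmod a" "cmod b"] by (simp add: power2_sum)
  finally show ?thesis .
qed

lemma square_summable_add:
  fixes f g :: "int \<Rightarrow> complex"
  assumes "(\<lambda>n. (cmod (f n))\<^sup>2) summable_on UNIV" "(\<lambda>n. (cmod (g n))\<^sup>2) summable_on UNIV"
  shows "(\<lambda>n. (cmod (f n + g n))\<^sup>2) summable_on UNIV"
  by (rule summable_on_comparison_test
        [of "\<lambda>n. 2 * (cmod (f n))\<^sup>2 + 2 * (cmod (g n))\<^sup>2"])
     (auto intro!: summable_on_add summable_on_cmult_right assms cmod_add_square_le)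

lemma square_summable_bounded_mult:
  fixes f g :: "int \<Rightarrow> complex"
  assumes "(\<lambda>n. (cmod (f n))\<^sup>2) summable_on UNIV" "\<And>n. cmod (g n) \<le> B"
  shows "(\<lambda>n. (cmod (g n * f n))\<^sup>2) summable_on UNIV"
proof (rule summable_on_comparison_test[of "\<lambda>n. B\<^sup>2 * (cmod (f n))\<^sup>2"])
  show "(cmod (g n * f n))\<^sup>2 \<le> B\<^sup>2 * (cmod (f n))\<^sup>2" for n
    using power_mono[OF assms(2)[of n], of 2]
    by (simp add: norm_mult power_mult_distrib mult_right_mono)
qed (auto intro!: summable_on_cmult_right assms)

lemma square_summable_shift:
  fixes f :: "int \<Rightarrow> complex"
  assumes "(\<lambda>n. (cmod (f n))\<^sup>2) summable_on UNIV"
  shows "(\<lambda>n. (cmod (f (n + k)))\<^sup>2) summable_on UNIV"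
proof -
  have "bij (\<lambda>n::int. n + k)"
    by (rule bij_betwI[where g = "\<lambda>n. n - k"]) simp_all
  from summable_on_reindex_bij_betw[OF this, of "\<lambda>n. (cmod (f n))\<^sup>2"] assms
  show ?thesis by simp
qed

lift_definition scaleC :: "complex \<Rightarrow> ell2 \<Rightarrow> ell2" is "\<lambda>c f n. c * f n"
  by (rule square_summable_bounded_mult[of _ "\<lambda>_. _"]) auto

lift_definition basis_vec :: "int \<Rightarrow> ell2" ("\<delta>") is "\<lambda>k n. if n = k then 1 else 0"
proof -
  fix k :: int
  show "(\<lambda>n. (cmod (if n = k then 1 else 0))\<^sup>2) summable_on UNIV"
    by (rule finite_nonzero_values_imp_summable_on) simp
qed

text \<open>Complex inner product, conjugate-linear in the first argument.\<close>

definition cinner :: "ell2 \<Rightarrow> ell2 \<Rightarrow> complex"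
  where "cinner f g = (\<Sum>\<^sub>\<infinity>n. cnj (coord f n) * coord g n)"

lemma cinner_abs_summable:
  "(\<lambda>n. cmod (cnj (coord f n) * coord g n)) summable_on UNIV"
proof (rule summable_on_comparison_test
        [of "\<lambda>n. (cmod (coord f n))\<^sup>2 + (cmod (coord g n))\<^sup>2"])
  show "cmod (cnj (coord f n) * coord g n) \<le> (cmod (coord f n))\<^sup>2 + (cmod (coord g n))\<^sup>2" for n
  proof -
    have "2 * (cmod (coord f n) * cmod (coord g n))
            \<le> (cmod (coord f n))\<^sup>2 + (cmod (coord g n))\<^sup>2"
      using sum_squares_bound[of "cmod (coord f n)" "cmod (coord g n)"] by simp
    moreover have "0 \<le> cmod (coord f n) * cmod (coord g n)" by simp
    ultimately show ?thesis unfolding norm_mult complex_mod_cnj by linarith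
  qed
qed (auto intro!: summable_on_add coord_summable)

lemma cinner_summable: "(\<lambda>n. cnj (coord f n) * coord g n) summable_on UNIV"
  using cinner_abs_summable by (rule abs_summable_summable)

text \<open>The real inner product is the real part of the complex one; through it the class
  \<^class>\<open>real_inner\<close> supplies the \<open>\<ell>\<^sup>2\<close> norm and the norm topology.\<close>

instantiation ell2 :: real_inner
begin

lift_definition zero_ell2 :: ell2 is "\<lambda>_. 0" by simp

lift_definition plus_ell2 :: "ell2 \<Rightarrow> ell2 \<Rightarrow> ell2" is "\<lambda>f g n. f n + g n"
  by (rule square_summable_add)

lift_definition uminus_ell2 :: "ell2 \<Rightarrow> ell2" is "\<lambda>f n. - f n" by simp

lift_definition minus_ell2 :: "ell2 \<Rightarrow> ell2 \<Rightarrow> ell2" is "\<lambda>f g n. f n - g n"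
  subgoal for f g using square_summable_add[of f "\<lambda>n. - g n"] by simp
  done

definition scaleR_ell2 :: "real \<Rightarrow> ell2 \<Rightarrow> ell2"
  where "scaleR_ell2 c f = scaleC (complex_of_real c) f"

definition inner_ell2 :: "ell2 \<Rightarrow> ell2 \<Rightarrow> real"
  where "inner_ell2 f g = Re (cinner f g)"

definition norm_ell2 :: "ell2 \<Rightarrow> real"
  where "norm_ell2 f = sqrt (inner f f)"

definition dist_ell2 :: "ell2 \<Rightarrow> ell2 \<Rightarrow> real"
  where "dist_ell2 f g = norm (f - g)"

definition sgn_ell2 :: "ell2 \<Rightarrow> ell2"
  where "sgn_ell2 f = inverse (norm f) *\<^sub>R f"

definition uniformity_ell2 :: "(ell2 \<times> ell2) filter"
  where "uniformity_ell2 = (INF e\<in>{0 <..}. principal {(x, y). dist x y < e})"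

definition open_ell2 :: "ell2 set \<Rightarrow> bool"
  where "open_ell2 U = (\<forall>x\<in>U. \<forall>\<^sub>F (x', y) in uniformity. x' = x \<longrightarrow> y \<in> U)"

lemma inner_ell2_eq: "inner f g = (\<Sum>\<^sub>\<infinity>n. Re (cnj (coord f n) * coord g n))"
  unfolding inner_ell2_def cinner_def
  by (rule infsum_Re[OF cinner_summable, symmetric])

lemma inner_ell2_summable: "(\<lambda>n. Re (cnj (coord f n) * coord g n)) summable_on UNIV"
  by (rule summable_on_Re[OF cinner_summable])

lemma inner_ell2_self: "inner f f = (\<Sum>\<^sub>\<infinity>n. (cmod (coord f n))\<^sup>2)"
  unfolding inner_ell2_eq by (intro infsum_cong) (simp add: cmod_power2, simp add: power2_eq_square)

instance
proof
  fix x y z :: ell2 and a b r :: real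
  show "x + y + z = x + (y + z)" "x + y = y + x" "0 + x = x" "- x + x = 0" "x - y = x + - y"
    by (auto intro!: ell2_eqI simp: plus_ell2.rep_eq zero_ell2.rep_eq uminus_ell2.rep_eq
        minus_ell2.rep_eq)
  show "a *\<^sub>R (x + y) = a *\<^sub>R x + a *\<^sub>R y" "(a + b) *\<^sub>R x = a *\<^sub>R x + b *\<^sub>R x"
    "a *\<^sub>R b *\<^sub>R x = (a * b) *\<^sub>R x" "1 *\<^sub>R x = x"
    by (auto intro!: ell2_eqI simp: scaleR_ell2_def scaleC.rep_eq plus_ell2.rep_eq algebra_simps)
  show "dist x y = norm (x - y)" by (rule dist_ell2_def)
  show "sgn x = inverse (norm x) *\<^sub>R x" by (rule sgn_ell2_def)
  show "uniformity = (INF e\<in>{0 <..}. principal {(x, y :: ell2). dist x y < e})"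
    by (rule uniformity_ell2_def)
  show "open U = (\<forall>x\<in>U. \<forall>\<^sub>F (x', y) in uniformity. x' = x \<longrightarrow> y \<in> U)" for U :: "ell2 set"
    by (rule open_ell2_def)
  show "inner x y = inner y x"
    unfolding inner_ell2_eq by (intro infsum_cong) simp
  show "inner (x + y) z = inner x z + inner y z"
    unfolding inner_ell2_eq
    by (subst infsum_add[symmetric, OF inner_ell2_summable inner_ell2_summable])
       (auto intro!: infsum_cong simp: plus_ell2.rep_eq algebra_simps)
  show "inner (r *\<^sub>R x) y = r * inner x y"
    unfolding inner_ell2_eq
    by (subst infsum_cmult_right'[symmetric])
       (auto intro!: infsum_cong simp: scaleR_ell2_def scaleC.rep_eq algebra_simps)
  show "0 \<le> inner x x"
    unfolding inner_ell2_self by (intro infsum_nonneg) simp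
  show "(inner x x = 0) = (x = 0)"
  proof
    assume "inner x x = 0"
    then have "(cmod (coord x n))\<^sup>2 = 0" for n
      unfolding inner_ell2_self
      by (intro nonneg_infsum_le_0D[OF _ coord_summable[of x]]) auto
    then show "x = 0"
      by (intro ell2_eqI) (simp add: zero_ell2.rep_eq)
  next
    assume "x = 0"
    then show "inner x x = 0" by (simp add: inner_ell2_self zero_ell2.rep_eq)
  qed
  show "norm x = sqrt (inner x x)" by (rule norm_ell2_def)
qed

end

lemma norm_ell2_eq: "norm f = sqrt (\<Sum>\<^sub>\<infinity>n. (cmod (coord f n))\<^sup>2)"
  by (simp add: norm_ell2_def inner_ell2_self)

lemma norm_ell2_square: "(norm f)\<^sup>2 = (\<Sum>\<^sub>\<infinity>n. (cmod (coord f n))\<^sup>2)"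
  unfolding norm_ell2_eq by (simp add: infsum_nonneg)

lemma sum_coord_le_norm:
  assumes "finite F"
  shows "(\<Sum>n\<in>F. (cmod (coord f n))\<^sup>2) \<le> (norm f)\<^sup>2"
  unfolding norm_ell2_square by (intro finite_sum_le_infsum coord_summable assms) auto

lemma coord_le_norm: "cmod (coord f n) \<le> norm f"
  using sum_coord_le_norm[of "{n}" f] by (auto intro: power2_le_imp_le)

lemma norm_ell2_leI:
  assumes "\<And>F. finite F \<Longrightarrow> (\<Sum>n\<in>F. (cmod (coord f n))\<^sup>2) \<le> B\<^sup>2" "0 \<le> B"
  shows "norm f \<le> B"
proof (rule power2_le_imp_le[OF _ assms(2)])
  show "(norm f)\<^sup>2 \<le> B\<^sup>2"
    unfolding norm_ell2_square by (intro infsum_le_finite_sums coord_summable assms(1))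
qed

instance ell2 :: banach
proof
  fix X :: "nat \<Rightarrow> ell2"
  assume X: "Cauchy X"
  have "Cauchy (\<lambda>k. coord (X k) n)" for n
  proof (rule metric_CauchyI)
    fix e :: real assume "e > 0"
    then obtain M where M: "\<And>k l. k \<ge> M \<Longrightarrow> l \<ge> M \<Longrightarrow> dist (X k) (X l) < e"
      using metric_CauchyD[OF X] by blast
    have "dist (coord (X k) n) (coord (X l) n) < e" if "k \<ge> M" "l \<ge> M" for k l
      using coord_le_norm[of "X k - X l" n] M[OF that]
      by (simp add: dist_norm minus_ell2.rep_eq)
    then show "\<exists>M. \<forall>k\<ge>M. \<forall>l\<ge>M. dist (coord (X k) n) (coord (X l) n) < e"
      by blast
  qed
  then have "\<exists>f. \<forall>n. (\<lambda>k. coord (X k) n) \<longlonglongrightarrow> f n"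
    by (intro choice allI) (simp add: Cauchy_convergent_iff convergent_def)
  then obtain f where f: "\<And>n. (\<lambda>k. coord (X k) n) \<longlonglongrightarrow> f n"
    by blast
  have tail: "(\<Sum>n\<in>F. (cmod (f n - coord (X l) n))\<^sup>2) \<le> e\<^sup>2"
    if M: "\<And>k l. k \<ge> M \<Longrightarrow> l \<ge> M \<Longrightarrow> dist (X k) (X l) < e" and "l \<ge> M" for M l e F
  proof (cases "finite F")
    case True
    show ?thesis
    proof (rule LIMSEQ_le_const2)
      show "(\<lambda>k. \<Sum>n\<in>F. (cmod (coord (X k) n - coord (X l) n))\<^sup>2)
              \<longlonglongrightarrow> (\<Sum>n\<in>F. (cmod (f n - coord (X l) n))\<^sup>2)"
        by (intro tendsto_intros f)
      have "(\<Sum>n\<in>F. (cmod (coord (X k) n - coord (X l) n))\<^sup>2) \<le> e\<^sup>2" if "k \<ge> M" for k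
      proof -
        have "(\<Sum>n\<in>F. (cmod (coord (X k) n - coord (X l) n))\<^sup>2) \<le> (norm (X k - X l))\<^sup>2"
          using sum_coord_le_norm[OF True, of "X k - X l"] by (simp add: minus_ell2.rep_eq)
        also have "\<dots> \<le> e\<^sup>2"
          using M[OF that \<open>l \<ge> M\<close>] by (intro power_mono) (auto simp: dist_norm)
        finally show ?thesis .
      qed
      then show "\<exists>N. \<forall>k\<ge>N. (\<Sum>n\<in>F. (cmod (coord (X k) n - coord (X l) n))\<^sup>2) \<le> e\<^sup>2"
        by blast
    qed
  qed simp
  obtain M1 where M1: "\<And>k l. k \<ge> M1 \<Longrightarrow> l \<ge> M1 \<Longrightarrow> dist (X k) (X l) < 1"
    using metric_CauchyD[OF X, of 1] by auto
  have "(\<lambda>n. (cmod (f n - coord (X M1) n))\<^sup>2) summable_on UNIV"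
    by (rule nonneg_bdd_above_summable_on)
       (auto intro!: bdd_aboveI2[where M = "1\<^sup>2"] tail[OF M1] simp del: one_power2)
  from square_summable_add[OF this coord_summable[of "X M1"]]
  have fs: "(\<lambda>n. (cmod (f n))\<^sup>2) summable_on UNIV" by simp
  define g where "g = Abs_ell2 f"
  have g: "coord g = f"
    unfolding g_def using fs by (intro Abs_ell2_inverse) simp
  have "X \<longlonglongrightarrow> g"
  proof (rule metric_LIMSEQ_I)
    fix e :: real assume "e > 0"
    then obtain M where M: "\<And>k l. k \<ge> M \<Longrightarrow> l \<ge> M \<Longrightarrow> dist (X k) (X l) < e / 2"
      using metric_CauchyD[OF X, of "e / 2"] by auto
    have "dist (X k) g < e" if "k \<ge> M" for k
    proof -
      have "norm (g - X k) \<le> e / 2"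
        using tail[OF M that] \<open>e > 0\<close>
        by (intro norm_ell2_leI) (auto simp: minus_ell2.rep_eq g)
      then show ?thesis
        using \<open>e > 0\<close> by (simp add: dist_norm norm_minus_commute)
    qed
    then show "\<exists>M. \<forall>k\<ge>M. dist (X k) g < e" by blast
  qed
  then show "convergent X" by (auto simp: convergent_def)
qed

section \<open>Operators\<close>

text \<open>Operators are bounded real-linear maps on \<open>\<ell>\<^sup>2\<close>; all the ones formed below are
  complex-linear. Scaling by a complex number is composition with the following operator.\<close>

lemma norm_scaleC: "norm (scaleC c f) = cmod c * norm f"
proof -
  have "(\<Sum>\<^sub>\<infinity>n. (cmod (coord (scaleC c f) n))\<^sup>2)
     = (\<Sum>\<^sub>\<infinity>n. (cmod c)\<^sup>2 * (cmod (coord f n))\<^sup>2)"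
    by (intro infsum_cong) (simp add: scaleC.rep_eq norm_mult power_mult_distrib)
  also have "\<dots> = (cmod c)\<^sup>2 * (\<Sum>\<^sub>\<infinity>n. (cmod (coord f n))\<^sup>2)"
    by (rule infsum_cmult_right')
  finally have *: "(\<Sum>\<^sub>\<infinity>n. (cmod (coord (scaleC c f) n))\<^sup>2) = \<dots>" .
  have "norm (scaleC c f) = sqrt ((cmod c)\<^sup>2 * (\<Sum>\<^sub>\<infinity>n. (cmod (coord f n))\<^sup>2))"
    by (subst norm_ell2_eq, subst *, rule refl)
  also have "\<dots> = cmod c * norm f"
    by (subst norm_ell2_eq, subst real_sqrt_mult, simp)
  finally show ?thesis .
qed

lemma bounded_linear_scaleC: "bounded_linear (scaleC c)"
proof (rule bounded_linear_intro[where K = "cmod c"])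
  show "scaleC c (x + y) = scaleC c x + scaleC c y" for x y
    by (rule ell2_eqI) (simp add: scaleC.rep_eq plus_ell2.rep_eq distrib_left)
  show "scaleC c (r *\<^sub>R x) = r *\<^sub>R scaleC c x" for r x
    by (rule ell2_eqI) (simp add: scaleR_ell2_def scaleC.rep_eq mult.left_commute)
  show "norm (scaleC c x) \<le> norm x * cmod c" for x
    by (simp add: norm_scaleC mult.commute)
qed

definition scaleC_op :: "complex \<Rightarrow> (ell2 \<Rightarrow>\<^sub>L ell2)"
  where "scaleC_op c = Blinfun (scaleC c)"

lemma scaleC_op_apply [simp]: "scaleC_op c f = scaleC c f"
  by (simp add: scaleC_op_def bounded_linear_Blinfun_apply[OF bounded_linear_scaleC])

definition blinfun_pow :: "('a::real_normed_vector \<Rightarrow>\<^sub>L 'a) \<Rightarrow> nat \<Rightarrow> ('a \<Rightarrow>\<^sub>L 'a)"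
  where "blinfun_pow A k = (((o\<^sub>L) A) ^^ k) id_blinfun"

text \<open>Exponential of a bounded operator; the series converges in operator norm.\<close>

definition exp_op :: "('a::banach \<Rightarrow>\<^sub>L 'a) \<Rightarrow> ('a \<Rightarrow>\<^sub>L 'a)"
  where "exp_op A = (\<Sum>k. blinfun_pow A k /\<^sub>R fact k)"

lemma norm_blinfun_pow_le: "norm (blinfun_pow A k) \<le> norm A ^ k"
proof (induction k)
  case 0
  show ?case by (simp add: blinfun_pow_def norm_blinfun_id_le)
next
  case (Suc k)
  have "norm (blinfun_pow A (Suc k)) \<le> norm A * norm (blinfun_pow A k)"
    by (simp add: blinfun_pow_def norm_blinfun_compose)
  also have "\<dots> \<le> norm A * norm A ^ k"
    using Suc.IH by (intro mult_left_mono) auto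
  finally show ?case by simp
qed

lemma exp_op_summable: "summable (\<lambda>k. blinfun_pow (A :: 'a::banach \<Rightarrow>\<^sub>L 'a) k /\<^sub>R fact k)"
proof (rule summable_comparison_test')
  show "summable (\<lambda>k. norm A ^ k /\<^sub>R fact k)"
    using summable_exp_generic[of "norm A"] .
  show "norm (blinfun_pow A k /\<^sub>R fact k) \<le> norm A ^ k /\<^sub>R fact k" if "k \<ge> 0" for k
    using norm_blinfun_pow_le[of A k] by (simp add: divide_simps)
qed

section \<open>The Schroedinger operator with potential \<open>\<omega>\<close>\<close>

definition schroedinger_fun :: "(int \<Rightarrow> real) \<Rightarrow> ell2 \<Rightarrow> int \<Rightarrow> complex"
  where "schroedinger_fun \<omega> \<psi> n =
    coord \<psi> (n + 1) + coord \<psi> (n - 1) + complex_of_real (\<omega> n) * coord \<psi> n"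

text \<open>For bounded \<open>\<omega>\<close>, \<open>Abs_ell2\<close> and \<open>Blinfun\<close> are applied to arguments in their domain;
  see \<open>coord_schroedinger\<close>. For unbounded \<open>\<omega>\<close> the value is meaningless.\<close>

definition schroedinger :: "(int \<Rightarrow> real) \<Rightarrow> (ell2 \<Rightarrow>\<^sub>L ell2)"
  where "schroedinger \<omega> = Blinfun (\<lambda>\<psi>. Abs_ell2 (schroedinger_fun \<omega> \<psi>))"

lemma norm_shift:
  assumes "\<And>n. coord g n = coord f (n + k)"
  shows "norm g = norm f"
proof -
  have "bij (\<lambda>n::int. n + k)"
    by (rule bij_betwI[where g = "\<lambda>n. n - k"]) simp_all
  from infsum_reindex_bij_betw[OF this, of "\<lambda>n. (cmod (coord f n))\<^sup>2"] show ?thesis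
    unfolding norm_ell2_eq assms by simp
qed

lemma schroedinger_wf:
  assumes B: "\<And>n. \<bar>\<omega> n\<bar> \<le> B"
  shows coord_Abs_schroedinger:
      "coord (Abs_ell2 (schroedinger_fun \<omega> \<psi>)) = schroedinger_fun \<omega> \<psi>"
    and bounded_linear_schroedinger:
      "bounded_linear (\<lambda>\<psi>. Abs_ell2 (schroedinger_fun \<omega> \<psi>))"
proof -
  let ?L = "\<lambda>\<psi>. Abs_ell2 (\<lambda>n. coord \<psi> (n + 1))"
  let ?R = "\<lambda>\<psi>. Abs_ell2 (\<lambda>n. coord \<psi> (n + (-1)))"
  let ?V = "\<lambda>\<psi>. Abs_ell2 (\<lambda>n. complex_of_real (\<omega> n) * coord \<psi> n)"
  have B0: "0 \<le> B" using B[of 0] by linarith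
  have L: "coord (?L \<psi>) = (\<lambda>n. coord \<psi> (n + 1))" for \<psi>
    by (rule Abs_ell2_inverse) (simp add: square_summable_shift coord_summable)
  have R: "coord (?R \<psi>) = (\<lambda>n. coord \<psi> (n + (-1)))" for \<psi>
    by (rule Abs_ell2_inverse, simp only: mem_Collect_eq)
       (rule square_summable_shift[OF coord_summable])
  have V: "coord (?V \<psi>) = (\<lambda>n. complex_of_real (\<omega> n) * coord \<psi> n)" for \<psi>
    by (rule Abs_ell2_inverse, simp only: mem_Collect_eq)
       (rule square_summable_bounded_mult[OF coord_summable, of _ B], simp add: B)
  have sum: "schroedinger_fun \<omega> \<psi> = coord (?L \<psi> + ?R \<psi> + ?V \<psi>)" for \<psi>
    unfolding plus_ell2.rep_eq L R V by (rule ext) (simp add: schroedinger_fun_def)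
  have eq: "Abs_ell2 (schroedinger_fun \<omega> \<psi>) = ?L \<psi> + ?R \<psi> + ?V \<psi>" for \<psi>
    unfolding sum[of \<psi>] by (rule coord_inverse)
  show coord: "coord (Abs_ell2 (schroedinger_fun \<omega> \<psi>)) = schroedinger_fun \<omega> \<psi>" for \<psi>
    unfolding eq[of \<psi>] by (rule sum[symmetric])
  have "norm (?V \<psi>) \<le> B * norm \<psi>" for \<psi>
  proof (rule norm_ell2_leI)
    fix F :: "int set" assume F: "finite F"
    have "(\<Sum>n\<in>F. (cmod (coord (?V \<psi>) n))\<^sup>2) \<le> (\<Sum>n\<in>F. B\<^sup>2 * (cmod (coord \<psi> n))\<^sup>2)"
      unfolding V
      by (intro sum_mono) (simp add: norm_mult power_mult_distrib mult_right_mono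
          abs_le_square_iff[symmetric] B abs_of_nonneg[OF B0])
    also have "\<dots> \<le> (B * norm \<psi>)\<^sup>2"
      using sum_coord_le_norm[OF F, of \<psi>]
      by (simp add: sum_distrib_left[symmetric] power_mult_distrib mult_left_mono)
    finally show "(\<Sum>n\<in>F. (cmod (coord (?V \<psi>) n))\<^sup>2) \<le> (B * norm \<psi>)\<^sup>2" .
  qed (simp add: B0)
  moreover have "norm (?L \<psi>) = norm \<psi>" for \<psi>
    by (rule norm_shift[where k = 1]) (simp add: L)
  moreover have "norm (?R \<psi>) = norm \<psi>" for \<psi>
    by (rule norm_shift[where k = "-1"]) (simp only: R)
  ultimately have "norm (?L \<psi> + ?R \<psi> + ?V \<psi>) \<le> norm \<psi> + norm \<psi> + B * norm \<psi>" for \<psi>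
    by (intro norm_triangle_le add_mono) auto
  then have bound: "norm (?L \<psi> + ?R \<psi> + ?V \<psi>) \<le> norm \<psi> * (2 + B)" for \<psi>
    by (simp add: algebra_simps)
  show "bounded_linear (\<lambda>\<psi>. Abs_ell2 (schroedinger_fun \<omega> \<psi>))"
  proof (rule bounded_linear_intro[where K = "2 + B"])
    show "norm (Abs_ell2 (schroedinger_fun \<omega> \<psi>)) \<le> norm \<psi> * (2 + B)" for \<psi>
      unfolding eq by (rule bound)
  qed (auto intro!: ell2_eqI simp: coord schroedinger_fun_def plus_ell2.rep_eq
        scaleR_ell2_def scaleC.rep_eq algebra_simps)
qed

lemma coord_schroedinger:
  assumes "\<And>n. \<bar>\<omega> n\<bar> \<le> B"
  shows "coord (schroedinger \<omega> \<psi>) n =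
    coord \<psi> (n + 1) + coord \<psi> (n - 1) + complex_of_real (\<omega> n) * coord \<psi> n"
  unfolding schroedinger_def
  by (simp add: bounded_linear_Blinfun_apply[OF bounded_linear_schroedinger[OF assms]]
      coord_Abs_schroedinger[OF assms] schroedinger_fun_def)

lemma cinner_shift_summable:
  "(\<lambda>n. cnj (coord f (n + k)) * coord g n) summable_on UNIV"
proof -
  define h where "h = Abs_ell2 (\<lambda>n. coord f (n + k))"
  have "coord h = (\<lambda>n. coord f (n + k))"
    unfolding h_def
    by (rule Abs_ell2_inverse, simp only: mem_Collect_eq)
       (rule square_summable_shift[OF coord_summable])
  then show ?thesis
    using cinner_summable[of h g] by simp
qed

lemma cinner_shift_eq:
  "(\<Sum>\<^sub>\<infinity>n. cnj (coord f (n + k)) * coord g n) = (\<Sum>\<^sub>\<infinity>n. cnj (coord f n) * coord g (n - k))"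
proof -
  have "bij (\<lambda>n::int. n + k)"
    by (rule bij_betwI[where g = "\<lambda>n. n - k"]) simp_all
  from infsum_reindex_bij_betw[OF this, of "\<lambda>n. cnj (coord f n) * coord g (n - k)"]
  show ?thesis by simp
qed

lemma schroedinger_self_adjoint:
  assumes B: "\<And>n. \<bar>\<omega> n\<bar> \<le> B"
  shows "cinner f (schroedinger \<omega> g) = cinner (schroedinger \<omega> f) g"
proof -
  let ?A = "\<lambda>k n. cnj (coord f n) * coord g (n - k)"
  let ?A' = "\<lambda>k n. cnj (coord f (n + k)) * coord g n"
  have A': "?A' k summable_on UNIV" for k
    by (rule cinner_shift_summable)
  have A: "?A k summable_on UNIV" for k
  proof -
    have "bij (\<lambda>n::int. n + k)"
      by (rule bij_betwI[where g = "\<lambda>n. n - k"]) simp_all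
    from summable_on_reindex_bij_betw[OF this, of "?A k"] A'[of k] show ?thesis by simp
  qed
  let ?D = "\<lambda>n. cnj (coord f n) * (complex_of_real (\<omega> n) * coord g n)"
  have D_eq: "?D = (\<lambda>n. cnj (coord f n) * coord (schroedinger \<omega> g) n + (-1) * (?A (-1) n + ?A 1 n))"
    by (rule ext) (simp add: coord_schroedinger[OF B] algebra_simps)
  have D: "?D summable_on UNIV"
    unfolding D_eq by (intro summable_on_cmult_right summable_on_add cinner_summable A)
  have "cinner f (schroedinger \<omega> g) = infsum (\<lambda>n. (?A (-1) n + ?A 1 n) + ?D n) UNIV"
    unfolding cinner_def
    by (rule infsum_cong) (simp add: coord_schroedinger[OF B] algebra_simps)
  also have "\<dots> = (infsum (?A (-1)) UNIV + infsum (?A 1) UNIV) + infsum ?D UNIV"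
    by (simp only: infsum_add summable_on_add A D)
  also have "\<dots> = (infsum (?A' (-1)) UNIV + infsum (?A' 1) UNIV) + infsum ?D UNIV"
    by (simp only: cinner_shift_eq)
  also have "\<dots> = infsum (\<lambda>n. (?A' (-1) n + ?A' 1 n) + ?D n) UNIV"
    by (simp only: infsum_add summable_on_add A' D)
  also have "\<dots> = cinner (schroedinger \<omega> f) g"
    unfolding cinner_def
    by (rule infsum_cong) (simp add: coord_schroedinger[OF B] algebra_simps)
  finally show ?thesis .
qed

definition evolution :: "(int \<Rightarrow> real) \<Rightarrow> real \<Rightarrow> (ell2 \<Rightarrow>\<^sub>L ell2)"
  where "evolution \<omega> t = exp_op (scaleC_op (- (\<i> * complex_of_real t)) o\<^sub>L schroedinger \<omega>)"

section \<open>Topological support of a Borel measure\<close>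

definition measure_support :: "'a::topological_space measure \<Rightarrow> 'a set"
  where "measure_support M = {x. \<forall>U. open U \<longrightarrow> x \<in> U \<longrightarrow> emeasure M U > 0}"

lemma measure_support_density_subset:
  assumes [measurable]: "r \<in> borel_measurable borel"
  shows "measure_support (density lborel (\<lambda>x. ennreal (r x))) \<subseteq> closure {x. r x \<noteq> 0}"
proof
  fix x assume x: "x \<in> measure_support (density lborel (\<lambda>x. ennreal (r x)))"
  show "x \<in> closure {x. r x \<noteq> 0}"
  proof (rule ccontr)
    let ?U = "- closure {x. r x \<noteq> 0}"
    assume "x \<notin> closure {x. r x \<noteq> 0}"
    moreover have "open ?U" by (intro open_Compl closed_closure)
    ultimately have "emeasure (density lborel (\<lambda>x. ennreal (r x))) ?U > 0"
      using x unfolding measure_support_def by blast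
    moreover have "emeasure (density lborel (\<lambda>x. ennreal (r x))) ?U
        = (\<integral>\<^sup>+x. ennreal (r x) * indicator ?U x \<partial>lborel)"
      by (subst emeasure_density) auto
    moreover have "\<dots> = (\<integral>\<^sup>+x. 0 \<partial>(lborel :: 'a measure))"
    proof (rule nn_integral_cong)
      fix x :: 'a
      show "ennreal (r x) * indicator ?U x = 0"
      proof (cases "r x = 0")
        case False
        then have "x \<in> closure {x. r x \<noteq> 0}"
          by (intro subsetD[OF closure_subset]) simp
        then show ?thesis by simp
      qed simp
    qed
    ultimately show False by simp
  qed
qed

lemma bounded_potential:
  fixes r :: "real \<Rightarrow> real"
  assumes r: "r \<in> borel_measurable borel" and "compact (closure {x. r x \<noteq> 0})"
    and \<omega>: "\<omega> \<in> (\<Pi>\<^sub>E n\<in>UNIV. measure_support (density lborel (\<lambda>x. ennreal (r x))))"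
  shows "\<exists>B. \<forall>n. \<bar>\<omega> n\<bar> \<le> B"
proof -
  from compact_imp_bounded[OF assms(2)]
  obtain B where B: "\<And>x. x \<in> closure {x. r x \<noteq> 0} \<Longrightarrow> \<bar>x\<bar> \<le> B"
    unfolding bounded_iff by auto
  have "\<bar>\<omega> n\<bar> \<le> B" for n
    by (rule B, rule subsetD[OF measure_support_density_subset[OF r]], rule PiE_mem[OF \<omega>]) simp
  then show ?thesis by blast
qed

end

theory Submission
  imports Defs "HOL-Computational_Algebra.Fundamental_Theorem_Algebra"
begin

text \<open>A simplified form of the Kunz--Souillard method. On a box centred at \<open>m\<close> the amplitude is bounded,
  uniformly in \<open>t\<close>, by the eigenfunction correlator (normalized \<open>\<phi>\<^sub>E\<close>) \<open>\<Sum>\<^sub>E \<bar>\<phi>\<^sub>E(m) \<phi>\<^sub>E(n)\<bar>\<close>. Only the potential \<open>v\<close> at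
  \<open>m\<close> is changed into the energy: the eigenvalue equation reads \<open>v = \<theta>(E)\<close> with \<open>\<theta>\<close> independent of
  \<open>v\<close> and \<open>d\<theta>/dE = 1 / \<bar>\<phi>\<^sub>E(m)\<bar>\<^sup>2\<close>, so that averaging over \<open>v\<close> turns the correlator into an energy
  integral of \<open>r(\<theta>(E)) \<bar>\<phi>\<^sub>E(n) / \<phi>\<^sub>E(m)\<bar>\<close>. The ratio is a product of Riccati variables
  \<open>\<zeta>' = 1 / (E - v - \<zeta>)\<close>, and integrating out the potentials between \<open>m\<close> and \<open>n\<close> iterates the positive
  operator \<open>T = K U\<close>, where \<open>U f(x) = f(1/x) / \<bar>x\<bar>\<close> is unitary and \<open>K\<close> averages translates with respect
  to \<open>\<nu>\<close>. On \<open>L\<^sup>2\<close> one has \<open>\<parallel>T\<^sup>2\<parallel> < 1\<close> uniformly in \<open>E\<close>: \<open>K\<close> loses little norm only on functions that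
  are nearly invariant under translations, and no \<open>f\<close> is such together with \<open>U f\<close>.\<close>

section \<open>Averaging of translates and inversion on square-integrable functions\<close>

text \<open>The bounded density gives both the entrance to and the exit from \<open>L^2\<close>. The
  initial function is \<open>r (E - c - z)\<close>, where \<open>c\<close> is the Riccati variable
  of the left half of the box; its squared norm is at most \<open>M\<close> whatever
  \<open>c\<close> is, so the left half needs no estimate. The last averaging turns an
  \<open>L^2\<close> bound into a pointwise one. The contraction factor depends only on an integer
  \<open>N >= 16 * M\<close>, hence is uniform in the energy and in the box. The spectral
  decomposition of a box comes from orthogonal polynomials: Christoffel-Darboux identities make the
  roots real and simple, the eigenvectors orthogonal and \<theta> increasing. Eigenvalues are never
  followed as functions of the potential; \<theta> is inverted piecewise between its singularities.
  The supremum over real times on the line is dominated by a lower limit of suprema over rational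
  times on growing boxes, which is measurable, so that Fatou's lemma applies.\<close>

lemma (in prob_space) variance_as_double_integral:
  fixes X :: "'a \<Rightarrow> real"
  assumes X[measurable]: "X \<in> borel_measurable M" and fin: "(\<integral>\<^sup>+x. ennreal ((X x)\<^sup>2) \<partial>M) < \<infinity>"
  shows "2 * ennreal ((expectation X)\<^sup>2) + (\<integral>\<^sup>+x. \<integral>\<^sup>+y. ennreal ((X x - X y)\<^sup>2) \<partial>M \<partial>M)
    = 2 * (\<integral>\<^sup>+x. ennreal ((X x)\<^sup>2) \<partial>M)"
proof -
  have i2: "integrable M (\<lambda>x. (X x)\<^sup>2)"
    using fin by (intro integrableI_bounded) auto
  have i1: "integrable M X"
    by (rule square_integrable_imp_integrable[OF X i2])
  have inner: "(\<integral>\<^sup>+y. ennreal ((X x - X y)\<^sup>2) \<partial>M)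
      = ennreal ((X x)\<^sup>2 - 2 * X x * expectation X + expectation (\<lambda>y. (X y)\<^sup>2))" for x
  proof -
    have eq: "(X x - X y)\<^sup>2 = (X x)\<^sup>2 - 2 * X x * X y + (X y)\<^sup>2" for y
      by (simp add: power2_diff)
    have int: "integrable M (\<lambda>y. (X x - X y)\<^sup>2)"
      unfolding eq using i1 i2 by auto
    have "(\<integral>\<^sup>+y. ennreal ((X x - X y)\<^sup>2) \<partial>M) = ennreal (expectation (\<lambda>y. (X x - X y)\<^sup>2))"
      by (rule nn_integral_eq_integral[OF int]) auto
    also have "expectation (\<lambda>y. (X x - X y)\<^sup>2)
        = (X x)\<^sup>2 - 2 * X x * expectation X + expectation (\<lambda>y. (X y)\<^sup>2)"
      unfolding eq using i1 i2 by (simp add: prob_space)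
    finally show ?thesis .
  qed
  have nonneg: "0 \<le> (X x)\<^sup>2 - 2 * X x * expectation X + expectation (\<lambda>y. (X y)\<^sup>2)" for x
  proof -
    have eq: "(X x - X y)\<^sup>2 = (X x)\<^sup>2 - 2 * X x * X y + (X y)\<^sup>2" for y
      by (simp add: power2_diff)
    have "0 \<le> expectation (\<lambda>y. (X x - X y)\<^sup>2)" by (intro integral_nonneg_AE) auto
    also have "expectation (\<lambda>y. (X x - X y)\<^sup>2)
        = (X x)\<^sup>2 - 2 * X x * expectation X + expectation (\<lambda>y. (X y)\<^sup>2)"
      unfolding eq using i1 i2 by (simp add: prob_space)
    finally show ?thesis .
  qed
  have "(\<integral>\<^sup>+x. \<integral>\<^sup>+y. ennreal ((X x - X y)\<^sup>2) \<partial>M \<partial>M)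
      = ennreal (expectation (\<lambda>x. (X x)\<^sup>2 - 2 * X x * expectation X + expectation (\<lambda>y. (X y)\<^sup>2)))"
    unfolding inner using i1 i2 nonneg by (intro nn_integral_eq_integral) auto
  also have "expectation (\<lambda>x. (X x)\<^sup>2 - 2 * X x * expectation X + expectation (\<lambda>y. (X y)\<^sup>2))
      = 2 * expectation (\<lambda>y. (X y)\<^sup>2) - 2 * (expectation X)\<^sup>2"
    using i1 i2 by (simp add: prob_space power2_eq_square)
  finally have A: "(\<integral>\<^sup>+x. \<integral>\<^sup>+y. ennreal ((X x - X y)\<^sup>2) \<partial>M \<partial>M)
      = ennreal (2 * expectation (\<lambda>y. (X y)\<^sup>2) - 2 * (expectation X)\<^sup>2)" .
  have var: "(expectation X)\<^sup>2 \<le> expectation (\<lambda>y. (X y)\<^sup>2)"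
    using variance_eq[OF i1 i2] variance_positive[of X] by simp
  have B: "(\<integral>\<^sup>+x. ennreal ((X x)\<^sup>2) \<partial>M) = ennreal (expectation (\<lambda>y. (X y)\<^sup>2))"
    by (rule nn_integral_eq_integral[OF i2]) auto
  have "2 * ennreal ((expectation X)\<^sup>2) + (\<integral>\<^sup>+x. \<integral>\<^sup>+y. ennreal ((X x - X y)\<^sup>2) \<partial>M \<partial>M)
     = ennreal (2 * (expectation X)\<^sup>2) + ennreal (2 * expectation (\<lambda>y. (X y)\<^sup>2) - 2 * (expectation X)\<^sup>2)"
    unfolding A by (simp add: ennreal_mult)
  also have "\<dots> = ennreal (2 * expectation (\<lambda>y. (X y)\<^sup>2))"
    using var by (subst ennreal_plus[symmetric]) auto
  also have "\<dots> = 2 * (\<integral>\<^sup>+x. ennreal ((X x)\<^sup>2) \<partial>M)"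
    unfolding B by (simp add: ennreal_mult)
  finally show ?thesis .
qed

section \<open>Changes of variables on the real line\<close>

lemma nn_integral_reflect:
  assumes [measurable]: "f \<in> borel_measurable borel"
  shows "(\<integral>\<^sup>+x. f (c - x) \<partial>lborel) = (\<integral>\<^sup>+x. f x \<partial>(lborel :: real measure))"
  by (subst (2) nn_integral_real_affine[where c = "-1" and t = c]) auto

lemma nn_integral_shift:
  assumes [measurable]: "f \<in> borel_measurable borel"
  shows "(\<integral>\<^sup>+x. f (c + x) \<partial>lborel) = (\<integral>\<^sup>+x. f x \<partial>(lborel :: real measure))"
  by (subst (2) nn_integral_real_affine[where c = 1 and t = c]) auto

text \<open>Later \<open>f\<close> contains an inverse branch of \<open>g\<close>, so measurability
  is known only for the pulled-back integrand. With \<open>fin\<close> that integrand is absolutely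
  integrable, and the change of variables transfers integrability, and with it Lebesgue
  measurability, to \<open>f\<close> on the image.\<close>

lemma
  fixes f g g' :: "real \<Rightarrow> real"
  assumes S[measurable]: "S \<in> sets borel"
    and der: "\<And>x. x \<in> S \<Longrightarrow> (g has_field_derivative g' x) (at x within S)"
    and inj: "inj_on g S"
    and meas[measurable]: "(\<lambda>x. indicator S x * (\<bar>g' x\<bar> * f (g x))) \<in> borel_measurable borel"
    and nn: "\<And>y. 0 \<le> f y"
    and fin: "(\<integral>\<^sup>+x. ennreal (indicator S x * (\<bar>g' x\<bar> * f (g x))) \<partial>lborel) < \<infinity>" (is "?R < \<infinity>")
  shows measurable_on_image: "(\<lambda>y. indicator (g ` S) y * f y) \<in> borel_measurable lebesgue"
    and nn_integral_on_image: "(\<integral>\<^sup>+y. ennreal (indicator (g ` S) y * f y) \<partial>lebesgue) = ?R"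
proof -
  have i: "integrable lborel (\<lambda>x. indicator S x * (\<bar>g' x\<bar> * f (g x)))"
    using fin nn by (intro integrableI_bounded) (auto simp: abs_mult)
  then have il: "integrable lebesgue (\<lambda>x. indicator S x * (\<bar>g' x\<bar> * f (g x)))"
    by (subst integrable_completion) auto
  have a: "(\<lambda>x. \<bar>g' x\<bar> * f (g x)) absolutely_integrable_on S"
    using il unfolding set_integrable_def by simp
  have "(\<lambda>x. \<bar>g' x\<bar> * f (g x)) absolutely_integrable_on S \<and>
      integral S (\<lambda>x. \<bar>g' x\<bar> * f (g x)) = integral S (\<lambda>x. \<bar>g' x\<bar> * f (g x)) \<longleftrightarrow>
      f absolutely_integrable_on (g ` S) \<and>
      integral (g ` S) f = integral S (\<lambda>x. \<bar>g' x\<bar> * f (g x))"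
    by (rule has_absolute_integral_change_of_variables_1') (auto simp: der inj)
  with a have b: "f absolutely_integrable_on (g ` S)" and
    e: "integral (g ` S) f = integral S (\<lambda>x. \<bar>g' x\<bar> * f (g x))"
    by auto
  have b': "integrable lebesgue (\<lambda>y. indicator (g ` S) y * f y)"
    using b unfolding set_integrable_def by simp
  then show "(\<lambda>y. indicator (g ` S) y * f y) \<in> borel_measurable lebesgue" by simp
  have "(\<integral>\<^sup>+y. ennreal (indicator (g ` S) y * f y) \<partial>lebesgue)
      = ennreal (\<integral>y. indicator (g ` S) y * f y \<partial>lebesgue)"
    using b' nn by (intro nn_integral_eq_integral) auto
  also have "(\<integral>y. indicator (g ` S) y * f y \<partial>lebesgue) = integral (g ` S) f"
    using set_lebesgue_integral_eq_integral(2)[OF b] unfolding set_lebesgue_integral_def by simp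
  also have "\<dots> = (\<integral>x. indicator S x * (\<bar>g' x\<bar> * f (g x)) \<partial>lebesgue)"
    unfolding e using set_lebesgue_integral_eq_integral(2)[OF a]
    unfolding set_lebesgue_integral_def by simp
  also have "\<dots> = (\<integral>x. indicator S x * (\<bar>g' x\<bar> * f (g x)) \<partial>lborel)"
    by (rule integral_completion) measurable
  also have "ennreal \<dots> = ?R"
    using i nn by (intro nn_integral_eq_integral[symmetric]) auto
  finally show "(\<integral>\<^sup>+y. ennreal (indicator (g ` S) y * f y) \<partial>lebesgue) = ?R" .
qed

text \<open>Substitution of \<open>1 / x\<close> on the punctured line. One direction suffices
  because \<open>1 / x\<close> is an involution, and an infinite right side makes the claim
  trivial.\<close>

lemma nn_integral_inverse_le:
  fixes f :: "real \<Rightarrow> real"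
  assumes f[measurable]: "f \<in> borel_measurable borel" and nn: "\<And>x. 0 \<le> f x"
  shows "(\<integral>\<^sup>+x. ennreal (f x) \<partial>lborel) \<le> (\<integral>\<^sup>+x. ennreal (f (1 / x) / x\<^sup>2) \<partial>lborel)"
proof -
  let ?S = "UNIV - {0 :: real}"
  have "x \<in> (\<lambda>x. 1 / x) ` ?S" if "x \<noteq> 0" for x :: real
    using that by (intro image_eqI[of _ _ "1 / x"]) auto
  then have img: "(\<lambda>x. 1 / x) ` ?S = ?S" by auto
  let ?R = "\<integral>\<^sup>+x. ennreal (indicator ?S x * (\<bar>- 1 / x\<^sup>2\<bar> * f (1 / x))) \<partial>lborel"
  have "(\<integral>\<^sup>+x. ennreal (f x) \<partial>lborel) = (\<integral>\<^sup>+x. ennreal (indicator ?S x * f x) \<partial>lborel)"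
    by (intro nn_integral_cong_AE) (use AE_lborel_singleton[of "0::real"] in eventually_elim, auto)
  also have "\<dots> = (\<integral>\<^sup>+x. ennreal (indicator ?S x * f x) \<partial>lebesgue)"
    by (subst nn_integral_completion) auto
  also have "\<dots> \<le> ?R"
  proof (cases "?R < \<infinity>")
    case True
    have "(\<integral>\<^sup>+x. ennreal (indicator ((\<lambda>x. 1 / x) ` ?S) x * f x) \<partial>lebesgue) = ?R"
    proof (rule nn_integral_on_image[where g' = "\<lambda>x. - 1 / x\<^sup>2"])
      show "((\<lambda>x. 1 / x) has_field_derivative - 1 / x\<^sup>2) (at x within ?S)" if "x \<in> ?S" for x
        using that by (auto intro!: derivative_eq_intros simp: power2_eq_square)
    qed (use True in \<open>auto simp: inj_on_def nn\<close>)
    then show ?thesis unfolding img by simp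
  qed (simp add: not_less top_unique)
  also have "\<dots> \<le> (\<integral>\<^sup>+x. ennreal (f (1 / x) / x\<^sup>2) \<partial>lborel)"
    using nn by (intro nn_integral_mono ennreal_leI) (auto simp: indicator_def)
  finally show ?thesis .
qed

section \<open>Loss of \<open>L^2\<close> norm under averaging\<close>

locale bounded_density =
  fixes r :: "real \<Rightarrow> real" and M :: real
  assumes r_measurable[measurable]: "r \<in> borel_measurable borel"
    and r_nonneg: "\<And>x. 0 \<le> r x" and r_le: "\<And>x. r x \<le> M"
    and nn_integral_r: "(\<integral>\<^sup>+x. ennreal (r x) \<partial>lborel) = 1"
begin

definition \<nu> :: "real measure" where "\<nu> = density lborel (\<lambda>x. ennreal (r x))"

lemma sets_\<nu>[measurable_cong, simp]: "sets \<nu> = sets borel" and space_\<nu>[simp]: "space \<nu> = UNIV"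
  by (simp_all add: \<nu>_def)

sublocale \<nu>: prob_space \<nu>
  by (rule prob_spaceI) (simp add: \<nu>_def emeasure_density nn_integral_r)

lemma swap_\<nu>_lborel:
  assumes [measurable]: "case_prod f \<in> borel_measurable (borel \<Otimes>\<^sub>M borel)"
  shows "(\<integral>\<^sup>+z. \<integral>\<^sup>+v. f z v \<partial>\<nu> \<partial>lborel) = (\<integral>\<^sup>+v. \<integral>\<^sup>+z. f z v \<partial>lborel \<partial>\<nu>)"
proof -
  interpret pair_sigma_finite lborel \<nu> ..
  show ?thesis by (rule Fubini'[symmetric]) measurable
qed

lemma M_nonneg: "0 \<le> M" using r_nonneg[of 0] r_le[of 0] by linarith

lemma nn_integral_\<nu>:
  assumes [measurable]: "f \<in> borel_measurable borel"
  shows "(\<integral>\<^sup>+x. f x \<partial>\<nu>) = (\<integral>\<^sup>+x. ennreal (r x) * f x \<partial>lborel)"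
  by (simp add: \<nu>_def nn_integral_density)

lemma nn_integral_\<nu>_le:
  assumes [measurable]: "f \<in> borel_measurable borel"
  shows "(\<integral>\<^sup>+x. f x \<partial>\<nu>) \<le> ennreal M * (\<integral>\<^sup>+x. f x \<partial>lborel)"
  unfolding nn_integral_\<nu>[OF assms]
  by (subst nn_integral_cmult[symmetric]) (auto intro!: nn_integral_mono mult_right_mono ennreal_leI r_le)

definition sqnorm :: "(real \<Rightarrow> real) \<Rightarrow> ennreal" where
  "sqnorm f = (\<integral>\<^sup>+x. ennreal ((f x)\<^sup>2) \<partial>lborel)"

definition dist_translate :: "(real \<Rightarrow> real) \<Rightarrow> real \<Rightarrow> ennreal" where
  "dist_translate f s = (\<integral>\<^sup>+x. ennreal ((f (x + s) - f x)\<^sup>2) \<partial>lborel)"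

definition osc :: "(real \<Rightarrow> real) \<Rightarrow> ennreal" where
  "osc f = (\<integral>\<^sup>+v. \<integral>\<^sup>+w. dist_translate f (v - w) \<partial>\<nu> \<partial>\<nu>)"

text \<open>The reflected argument comes from the Riccati step: \<open>transfer E f z\<close>
  averages \<open>f z' * \<bar>z'\<bar>\<close> over the potential \<open>v\<close>, where
  \<open>z' = 1 / (E - v - z)\<close>. Reflections preserve Lebesgue measure, so only the
  translation by \<open>v\<close> affects norms.\<close>

definition avg :: "real \<Rightarrow> (real \<Rightarrow> real) \<Rightarrow> real \<Rightarrow> real" where
  "avg E f z = (\<integral>v. f (E - v - z) \<partial>\<nu>)"

definition invert :: "(real \<Rightarrow> real) \<Rightarrow> real \<Rightarrow> real" where
  "invert f x = f (1 / x) / \<bar>x\<bar>"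

definition transfer :: "real \<Rightarrow> (real \<Rightarrow> real) \<Rightarrow> real \<Rightarrow> real" where
  "transfer E f = avg E (invert f)"

lemma avg_measurable[measurable]:
  assumes [measurable]: "f \<in> borel_measurable borel"
  shows "avg E f \<in> borel_measurable borel"
  unfolding avg_def[abs_def] by measurable

lemma invert_measurable[measurable]:
  assumes [measurable]: "f \<in> borel_measurable borel"
  shows "invert f \<in> borel_measurable borel"
  unfolding invert_def[abs_def] by measurable

lemma dist_translate_measurable[measurable]:
  assumes [measurable]: "f \<in> borel_measurable borel"
  shows "dist_translate f \<in> borel_measurable borel"
  unfolding dist_translate_def[abs_def] by measurable

lemma dist_translate_minus:
  assumes [measurable]: "f \<in> borel_measurable borel"
  shows "dist_translate f (- s) = dist_translate f s"
  unfolding dist_translate_def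
  by (subst nn_integral_shift[of _ s, symmetric]) (auto simp: power2_commute add.commute)

lemma nn_integral_square_\<nu>_le:
  assumes [measurable]: "f \<in> borel_measurable borel"
  shows "(\<integral>\<^sup>+v. ennreal ((f (c - v))\<^sup>2) \<partial>\<nu>) \<le> ennreal M * sqnorm f"
  unfolding sqnorm_def
  by (subst nn_integral_reflect[of "\<lambda>x. ennreal ((f x)\<^sup>2)" c, symmetric])
     (auto intro: nn_integral_\<nu>_le)

lemma square_integral_\<nu>_le:
  assumes [measurable]: "f \<in> borel_measurable borel" and "(\<integral>\<^sup>+v. ennreal ((f v)\<^sup>2) \<partial>\<nu>) < \<infinity>"
  shows "ennreal ((\<integral>v. f v \<partial>\<nu>)\<^sup>2) \<le> (\<integral>\<^sup>+v. ennreal ((f v)\<^sup>2) \<partial>\<nu>)"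
proof -
  have "2 * ennreal ((\<integral>v. f v \<partial>\<nu>)\<^sup>2) \<le> 2 * (\<integral>\<^sup>+v. ennreal ((f v)\<^sup>2) \<partial>\<nu>)"
    by (subst \<nu>.variance_as_double_integral[of f, symmetric]) (use assms(2) in auto)
  then show ?thesis
    by (subst (asm) ennreal_mult_le_mult_iff) auto
qed

text \<open>For fixed \<open>z\<close> this is the identity between a variance and a double integral
  of squared differences. Integration over \<open>z\<close> turns those differences into distances
  between translates, so \<open>osc f\<close> is exactly twice the squared norm lost. The additive
  form avoids subtraction in \<open>ennreal\<close>.\<close>

lemma avg_energy_identity:
  assumes f[measurable]: "f \<in> borel_measurable borel" and fin: "sqnorm f < \<infinity>"
  shows "2 * sqnorm (avg E f) + osc f = 2 * sqnorm f"
proof -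
  have fin': "(\<integral>\<^sup>+v. ennreal ((f (E - v - z))\<^sup>2) \<partial>\<nu>) < \<infinity>" for z
  proof -
    have "(\<integral>\<^sup>+v. ennreal ((f (E - v - z))\<^sup>2) \<partial>\<nu>) \<le> ennreal M * sqnorm f"
      using nn_integral_square_\<nu>_le[OF f, of "E - z"] by (simp add: algebra_simps)
    also have "\<dots> < \<infinity>" using fin by (simp add: ennreal_mult_less_top)
    finally show ?thesis .
  qed
  have "2 * sqnorm (avg E f) +
      (\<integral>\<^sup>+z. (\<integral>\<^sup>+v. \<integral>\<^sup>+w. ennreal ((f (E - v - z) - f (E - w - z))\<^sup>2) \<partial>\<nu> \<partial>\<nu>) \<partial>lborel)
     = (\<integral>\<^sup>+z. (2 * ennreal ((avg E f z)\<^sup>2) +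
      (\<integral>\<^sup>+v. \<integral>\<^sup>+w. ennreal ((f (E - v - z) - f (E - w - z))\<^sup>2) \<partial>\<nu> \<partial>\<nu>)) \<partial>lborel)"
    unfolding sqnorm_def by (subst nn_integral_add, measurable) (simp add: nn_integral_cmult)
  also have "\<dots> = (\<integral>\<^sup>+z. 2 * (\<integral>\<^sup>+v. ennreal ((f (E - v - z))\<^sup>2) \<partial>\<nu>) \<partial>lborel)"
    unfolding avg_def by (intro nn_integral_cong \<nu>.variance_as_double_integral fin') measurable
  also have "\<dots> = 2 * (\<integral>\<^sup>+v. \<integral>\<^sup>+z. ennreal ((f (E - v - z))\<^sup>2) \<partial>lborel \<partial>\<nu>)"
    by (subst nn_integral_cmult, measurable) (subst swap_\<nu>_lborel, auto)
  also have "\<dots> = 2 * sqnorm f"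
    using nn_integral_reflect[of "\<lambda>x. ennreal ((f x)\<^sup>2)"] by (simp add: sqnorm_def \<nu>.emeasure_space_1[simplified])
  also have "(\<integral>\<^sup>+z. (\<integral>\<^sup>+v. \<integral>\<^sup>+w. ennreal ((f (E - v - z) - f (E - w - z))\<^sup>2) \<partial>\<nu> \<partial>\<nu>) \<partial>lborel)
     = (\<integral>\<^sup>+v. \<integral>\<^sup>+w. \<integral>\<^sup>+z. ennreal ((f (E - v - z) - f (E - w - z))\<^sup>2) \<partial>lborel \<partial>\<nu> \<partial>\<nu>)"
    by (subst swap_\<nu>_lborel, measurable) (subst swap_\<nu>_lborel, auto)
  also have "\<dots> = osc f"
  proof -
    have "(\<integral>\<^sup>+z. ennreal ((f (E - v - z) - f (E - w - z))\<^sup>2) \<partial>lborel) = dist_translate f (v - w)" for v w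
      unfolding dist_translate_def
      by (subst nn_integral_reflect[of _ "E - v", symmetric]) (auto simp: power2_commute algebra_simps)
    then show ?thesis by (simp add: osc_def)
  qed
  finally show ?thesis .
qed

lemma sqnorm_avg_le:
  assumes f[measurable]: "f \<in> borel_measurable borel"
  shows "sqnorm (avg E f) \<le> sqnorm f"
proof (cases "sqnorm f < \<infinity>")
  case True
  have "2 * sqnorm (avg E f) \<le> 2 * sqnorm f"
    unfolding avg_energy_identity[OF f True, of E, symmetric] by simp
  then show ?thesis
    by (subst (asm) ennreal_mult_le_mult_iff) auto
qed (simp add: not_less top_unique)

text \<open>Jensen's inequality and the bound \<open>M\<close> on the density: averaging maps
  \<open>L^2\<close> into bounded functions.\<close>

lemma avg_square_le:
  assumes f[measurable]: "f \<in> borel_measurable borel" and fin: "sqnorm f < \<infinity>"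
  shows "ennreal ((avg E f z)\<^sup>2) \<le> ennreal M * sqnorm f"
proof -
  have *: "(\<integral>\<^sup>+v. ennreal ((f (E - v - z))\<^sup>2) \<partial>\<nu>) \<le> ennreal M * sqnorm f"
    using nn_integral_square_\<nu>_le[OF f, of "E - z"] by (simp add: algebra_simps)
  also have "\<dots> < \<infinity>" using fin by (simp add: ennreal_mult_less_top)
  finally have "ennreal ((avg E f z)\<^sup>2) \<le> (\<integral>\<^sup>+v. ennreal ((f (E - v - z))\<^sup>2) \<partial>\<nu>)"
    unfolding avg_def by (intro square_integral_\<nu>_le) auto
  then show ?thesis using * by (rule order_trans)
qed

lemma avg_integrable:
  assumes f[measurable]: "f \<in> borel_measurable borel" and fin: "sqnorm f < \<infinity>"
  shows "integrable \<nu> (\<lambda>v. f (E - v - z))"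
proof (rule \<nu>.square_integrable_imp_integrable)
  have "(\<integral>\<^sup>+v. ennreal ((f (E - v - z))\<^sup>2) \<partial>\<nu>) \<le> ennreal M * sqnorm f"
    using nn_integral_square_\<nu>_le[OF f, of "E - z"] by (simp add: algebra_simps)
  also have "\<dots> < \<infinity>" using fin by (simp add: ennreal_mult_less_top)
  finally show "integrable \<nu> (\<lambda>v. (f (E - v - z))\<^sup>2)"
    by (intro integrableI_bounded) auto
qed measurable

text \<open>Averaging intertwines translation by \<open>s\<close> with translation by
  \<open>- s\<close>, and by Jensen it contracts \<open>L^2\<close>. So near invariance under
  translations survives a transfer step.\<close>

lemma dist_translate_avg_le:
  assumes f[measurable]: "f \<in> borel_measurable borel" and fin: "sqnorm f < \<infinity>"
  shows "dist_translate (avg E f) s \<le> dist_translate f s"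
proof -
  have dt: "(\<integral>\<^sup>+z. ennreal ((f (E - v - (z + s)) - f (E - v - z))\<^sup>2) \<partial>lborel) = dist_translate f s" for v
    by (subst dist_translate_minus[symmetric], simp, unfold dist_translate_def,
        subst nn_integral_reflect[of _ "E - v", symmetric]) (auto simp: power2_commute algebra_simps)
  have "(avg E f (z + s) - avg E f z) = (\<integral>v. (f (E - v - (z + s)) - f (E - v - z)) \<partial>\<nu>)" for z
    unfolding avg_def by (intro Bochner_Integration.integral_diff[symmetric] avg_integrable fin f)
  moreover have "ennreal ((\<integral>v. (f (E - v - (z + s)) - f (E - v - z)) \<partial>\<nu>)\<^sup>2)
      \<le> (\<integral>\<^sup>+v. ennreal ((f (E - v - (z + s)) - f (E - v - z))\<^sup>2) \<partial>\<nu>)" for z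
  proof (cases "(\<integral>\<^sup>+v. ennreal ((f (E - v - (z + s)) - f (E - v - z))\<^sup>2) \<partial>\<nu>) < \<infinity>")
    case True then show ?thesis by (intro square_integral_\<nu>_le) auto
  qed (simp add: not_less top_unique)
  ultimately have "dist_translate (avg E f) s
      \<le> (\<integral>\<^sup>+z. \<integral>\<^sup>+v. ennreal ((f (E - v - (z + s)) - f (E - v - z))\<^sup>2) \<partial>\<nu> \<partial>lborel)"
    unfolding dist_translate_def by (intro nn_integral_mono) auto
  also have "\<dots> = (\<integral>\<^sup>+v. \<integral>\<^sup>+z. ennreal ((f (E - v - (z + s)) - f (E - v - z))\<^sup>2) \<partial>lborel \<partial>\<nu>)"
    by (rule swap_\<nu>_lborel) measurable
  also have "\<dots> = dist_translate f s"
    unfolding dt by (simp add: \<nu>.emeasure_space_1[simplified])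
  finally show ?thesis .
qed

lemma osc_avg_le:
  assumes "f \<in> borel_measurable borel" "sqnorm f < \<infinity>"
  shows "osc (avg E f) \<le> osc f"
  unfolding osc_def by (intro nn_integral_mono dist_translate_avg_le assms)

lemma sqnorm_invert_le:
  assumes f[measurable]: "f \<in> borel_measurable borel"
  shows "sqnorm (invert f) \<le> sqnorm f"
proof -
  have "sqnorm (invert f) \<le> (\<integral>\<^sup>+x. ennreal ((invert f (1 / x))\<^sup>2 / x\<^sup>2) \<partial>lborel)"
    unfolding sqnorm_def by (intro nn_integral_inverse_le) auto
  also have "\<dots> = sqnorm f"
    unfolding sqnorm_def
    by (intro nn_integral_cong_AE) (use AE_lborel_singleton[of "0::real"] in eventually_elim,
        auto simp: invert_def power_mult_distrib power_divide)
  finally show ?thesis .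
qed

section \<open>Near invariance and the location of mass\<close>

lemma mass_outside_le:
  assumes f[measurable]: "f \<in> borel_measurable borel"
  shows "(\<integral>\<^sup>+x. ennreal (indicator {x. \<bar>x\<bar> > 1} x * (f x)\<^sup>2) \<partial>lborel)
    \<le> (\<integral>\<^sup>+x. ennreal (indicator {-1..1} x * (invert f x)\<^sup>2) \<partial>lborel)"
proof -
  have "(\<integral>\<^sup>+x. ennreal (indicator {x. \<bar>x\<bar> > 1} x * (f x)\<^sup>2) \<partial>lborel)
    \<le> (\<integral>\<^sup>+x. ennreal (indicator {x. \<bar>x\<bar> > 1} (1 / x) * (f (1 / x))\<^sup>2 / x\<^sup>2) \<partial>lborel)"
    by (intro nn_integral_inverse_le) auto
  also have "\<dots> \<le> (\<integral>\<^sup>+x. ennreal (indicator {-1..1} x * (invert f x)\<^sup>2) \<partial>lborel)"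
    by (intro nn_integral_mono ennreal_leI)
       (auto simp: indicator_def invert_def power_mult_distrib power_divide field_simps abs_le_iff split: if_splits)
  finally show ?thesis .
qed

text \<open>Telescoping into \<open>N\<close> steps of length \<open>s\<close>, with Cauchy-Schwarz.
  The factor \<open>N^2\<close> is the price of a translation long enough to move mass away from a
  fixed window.\<close>

lemma dist_translate_multiple_le:
  assumes f[measurable]: "f \<in> borel_measurable borel"
  shows "dist_translate f (real N * s) \<le> (ennreal (real N))\<^sup>2 * dist_translate f s"
proof -
  let ?g = "\<lambda>i x. f (x + real (Suc i) * s) - f (x + real i * s)"
  have "(f (x + real N * s) - f x)\<^sup>2 \<le> real N * (\<Sum>i<N. (?g i x)\<^sup>2)" for x
  proof -
    have "(f (x + real N * s) - f x)\<^sup>2 = (\<Sum>i<N. ?g i x)\<^sup>2"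
      using sum_lessThan_telescope[of "\<lambda>i. f (x + real i * s)" N] by simp
    also have "\<dots> \<le> (\<Sum>i<N. (?g i x)\<^sup>2) * real (card {..<N})"
      by (rule sum_squared_le_sum_of_squares)
    finally show ?thesis by (simp add: mult.commute)
  qed
  then have "dist_translate f (real N * s) \<le> (\<integral>\<^sup>+x. ennreal (real N * (\<Sum>i<N. (?g i x)\<^sup>2)) \<partial>lborel)"
    unfolding dist_translate_def by (intro nn_integral_mono ennreal_leI)
  also have "\<dots> = ennreal (real N) * (\<Sum>i<N. \<integral>\<^sup>+x. ennreal ((?g i x)\<^sup>2) \<partial>lborel)"
    by (subst nn_integral_sum[symmetric], measurable, subst nn_integral_cmult[symmetric])
       (auto simp: ennreal_mult sum_nonneg)
  also have "(\<lambda>i. \<integral>\<^sup>+x. ennreal ((?g i x)\<^sup>2) \<partial>lborel) = (\<lambda>i. dist_translate f s)"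
    unfolding dist_translate_def
    by (rule ext, subst (2) nn_integral_shift[of _ "real _ * s", symmetric]) (auto simp: algebra_simps)
  finally show ?thesis by (simp add: power2_eq_square mult.assoc ennreal_of_nat_eq_real_of_nat)
qed

text \<open>For fixed \<open>x\<close> and \<open>w\<close> the law of
  \<open>x + N * (v - w)\<close> has density at most \<open>M / N\<close>, so \<open>f^2\<close> has
  mean at most \<open>M / N * sqnorm f\<close> there. The window \<open>{-1..1}\<close> contributes
  its length 2.\<close>

lemma local_mass_translate_le:
  assumes f[measurable]: "f \<in> borel_measurable borel" and N: "N > 0"
  shows "(\<integral>\<^sup>+v. \<integral>\<^sup>+w. \<integral>\<^sup>+x. ennreal (indicator {-1..1} x * (f (x + real N * (v - w)))\<^sup>2) \<partial>lborel \<partial>\<nu> \<partial>\<nu>)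
    \<le> ennreal (2 * M / real N) * sqnorm f"
proof -
  have inner: "(\<integral>\<^sup>+v. ennreal ((f (x + real N * (v - w)))\<^sup>2) \<partial>\<nu>) \<le> ennreal (M / real N) * sqnorm f" for x w
  proof -
    have "(\<integral>\<^sup>+v. ennreal ((f (x + real N * (v - w)))\<^sup>2) \<partial>\<nu>)
        \<le> ennreal M * (\<integral>\<^sup>+v. ennreal ((f (x + real N * (v - w)))\<^sup>2) \<partial>lborel)"
      by (rule nn_integral_\<nu>_le) measurable
    also have "(\<integral>\<^sup>+v. ennreal ((f (x + real N * (v - w)))\<^sup>2) \<partial>lborel)
        = ennreal (1 / real N) * (ennreal (real N) * (\<integral>\<^sup>+v. ennreal ((f ((x - real N * w) + real N * v))\<^sup>2) \<partial>lborel))"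
      using N by (simp add: mult.assoc[symmetric] ennreal_mult[symmetric] algebra_simps)
    also have "\<dots> = ennreal (1 / real N) * sqnorm f"
      unfolding sqnorm_def using N by (subst (2) nn_integral_real_affine[where c = "real N" and t = "x - real N * w"]) auto
    finally show ?thesis
      using M_nonneg by (simp add: mult.assoc[symmetric] ennreal_mult[symmetric])
  qed
  have "(\<integral>\<^sup>+v. \<integral>\<^sup>+w. \<integral>\<^sup>+x. ennreal (indicator {-1..1} x * (f (x + real N * (v - w)))\<^sup>2) \<partial>lborel \<partial>\<nu> \<partial>\<nu>)
     = (\<integral>\<^sup>+x. \<integral>\<^sup>+v. \<integral>\<^sup>+w. ennreal (indicator {-1..1} x * (f (x + real N * (v - w)))\<^sup>2) \<partial>\<nu> \<partial>\<nu> \<partial>lborel)"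
    by (subst (1) swap_\<nu>_lborel, measurable) (subst (1) swap_\<nu>_lborel[symmetric], auto)
  also have "\<dots> = (\<integral>\<^sup>+x. \<integral>\<^sup>+w. \<integral>\<^sup>+v. ennreal (indicator {-1..1} x * (f (x + real N * (v - w)))\<^sup>2) \<partial>\<nu> \<partial>\<nu> \<partial>lborel)"
  proof -
    interpret pair_sigma_finite \<nu> \<nu> ..
    show ?thesis by (intro nn_integral_cong Fubini') measurable
  qed
  also have "\<dots> = (\<integral>\<^sup>+x. indicator {-1..1} x * (\<integral>\<^sup>+w. \<integral>\<^sup>+v. ennreal ((f (x + real N * (v - w)))\<^sup>2) \<partial>\<nu> \<partial>\<nu>) \<partial>lborel)"
    by (intro nn_integral_cong) (auto simp: indicator_def)
  also have "\<dots> \<le> (\<integral>\<^sup>+(x :: real). indicator {-1..1} x * (ennreal (M / real N) * sqnorm f) \<partial>lborel)"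
  proof (intro nn_integral_mono mult_left_mono)
    fix x :: real
    have "(\<integral>\<^sup>+w. \<integral>\<^sup>+v. ennreal ((f (x + real N * (v - w)))\<^sup>2) \<partial>\<nu> \<partial>\<nu>)
        \<le> (\<integral>\<^sup>+w. (ennreal (M / real N) * sqnorm f) \<partial>\<nu>)"
      by (intro nn_integral_mono inner)
    then show "(\<integral>\<^sup>+w. \<integral>\<^sup>+v. ennreal ((f (x + real N * (v - w)))\<^sup>2) \<partial>\<nu> \<partial>\<nu>) \<le> ennreal (M / real N) * sqnorm f"
      by (simp add: \<nu>.emeasure_space_1[simplified])
  qed simp
  also have "\<dots> = ennreal (2 * M / real N) * sqnorm f"
    using M_nonneg by (subst nn_integral_multc) (auto simp: mult.assoc[symmetric] ennreal_mult[symmetric] numeral_mult_ennreal)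
  finally show ?thesis .
qed

text \<open>Compare \<open>f\<close> with its translate by \<open>N * (v - w)\<close> and average
  over both potentials: the translate has little mass in the window, and the difference is
  controlled by \<open>osc f\<close>.\<close>

lemma local_mass_le:
  assumes f[measurable]: "f \<in> borel_measurable borel" and N: "N > 0"
  shows "(\<integral>\<^sup>+x. ennreal (indicator {-1..1} x * (f x)\<^sup>2) \<partial>lborel)
    \<le> ennreal (4 * M / real N) * sqnorm f + 2 * (ennreal (real N))\<^sup>2 * osc f"
proof -
  let ?I = "\<integral>\<^sup>+x. ennreal (indicator {-1..1} x * (f x)\<^sup>2) \<partial>lborel"
  let ?J = "\<lambda>v w. \<integral>\<^sup>+x. ennreal (indicator {-1..1} x * (f (x + real N * (v - w)))\<^sup>2) \<partial>lborel"
  have "?I \<le> 2 * ?J v w + 2 * ((ennreal (real N))\<^sup>2 * dist_translate f (v - w))" for v w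
  proof -
    let ?s = "real N * (v - w)"
    have pt: "indicator {-1..1} x * (f x)\<^sup>2 \<le> 2 * (indicator {-1..1} x * (f (x + ?s))\<^sup>2) + 2 * (f (x + ?s) - f x)\<^sup>2" for x
    proof -
      \<comment> \<open>With \<open>a = f x\<close> and \<open>b = f (x + ?s)\<close>, this square
        is the slack, up to a further \<open>a^2\<close>, in
        \<open>a^2 <= 2 * b^2 + 2 * (b - a)^2\<close>.\<close>
      have "0 \<le> (2 * f (x + ?s) - f x)\<^sup>2" by simp
      then have "(f x)\<^sup>2 \<le> 2 * (f (x + ?s))\<^sup>2 + 2 * (f (x + ?s) - f x)\<^sup>2"
        by (simp add: power2_eq_square algebra_simps)
      then show ?thesis by (auto simp: indicator_def)
    qed
    have "?I \<le> (\<integral>\<^sup>+x. 2 * ennreal (indicator {-1..1} x * (f (x + ?s))\<^sup>2) + 2 * ennreal ((f (x + ?s) - f x)\<^sup>2) \<partial>lborel)"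
      using ennreal_leI[OF pt] by (intro nn_integral_mono) (simp add: ennreal_mult)
    also have "\<dots> = 2 * ?J v w + 2 * dist_translate f ?s"
      unfolding dist_translate_def
      by (subst nn_integral_add, measurable) (simp add: nn_integral_cmult)
    also have "\<dots> \<le> 2 * ?J v w + 2 * ((ennreal (real N))\<^sup>2 * dist_translate f (v - w))"
      by (intro add_left_mono mult_left_mono dist_translate_multiple_le) auto
    finally show ?thesis .
  qed
  then have "(\<integral>\<^sup>+v. \<integral>\<^sup>+w. ?I \<partial>\<nu> \<partial>\<nu>)
      \<le> (\<integral>\<^sup>+v. \<integral>\<^sup>+w. 2 * ?J v w + 2 * ((ennreal (real N))\<^sup>2 * dist_translate f (v - w)) \<partial>\<nu> \<partial>\<nu>)"
    by (intro nn_integral_mono) auto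
  also have "\<dots> = 2 * (\<integral>\<^sup>+v. \<integral>\<^sup>+w. ?J v w \<partial>\<nu> \<partial>\<nu>) + 2 * ((ennreal (real N))\<^sup>2 * osc f)"
    unfolding osc_def by (simp add: nn_integral_add nn_integral_cmult)
  also have "\<dots> \<le> 2 * (ennreal (2 * M / real N) * sqnorm f) + 2 * ((ennreal (real N))\<^sup>2 * osc f)"
    by (intro add_right_mono mult_left_mono local_mass_translate_le N f) auto
  also have "\<dots> = ennreal (4 * M / real N) * sqnorm f + 2 * (ennreal (real N))\<^sup>2 * osc f"
    using M_nonneg by (simp add: mult.assoc[symmetric] numeral_mult_ennreal)
  finally show ?thesis by (simp add: \<nu>.emeasure_space_1[simplified])
qed

text \<open>Near translation invariance of \<open>f\<close> spreads its mass out of \<open>{-1..1}\<close>; that of \<open>invert f\<close> makes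
  the mass of \<open>f\<close> outside \<open>{-1..1}\<close> small.\<close>

lemma sqnorm_le_osc:
  assumes f[measurable]: "f \<in> borel_measurable borel" and fin: "sqnorm f < \<infinity>"
    and N: "N > 0" "16 * M \<le> real N"
  shows "sqnorm f \<le> ennreal (4 * (real N)\<^sup>2) * (osc f + osc (invert f))"
proof -
  have "sqnorm f = (\<integral>\<^sup>+x. ennreal (indicator {-1..1} x * (f x)\<^sup>2) + ennreal (indicator {x. \<bar>x\<bar> > 1} x * (f x)\<^sup>2) \<partial>lborel)"
    unfolding sqnorm_def by (intro nn_integral_cong) (auto simp: indicator_def)
  also have "\<dots> = (\<integral>\<^sup>+x. ennreal (indicator {-1..1} x * (f x)\<^sup>2) \<partial>lborel)
      + (\<integral>\<^sup>+x. ennreal (indicator {x. \<bar>x\<bar> > 1} x * (f x)\<^sup>2) \<partial>lborel)"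
    by (rule nn_integral_add) measurable
  also have "\<dots> \<le> (ennreal (4 * M / real N) * sqnorm f + 2 * (ennreal (real N))\<^sup>2 * osc f) +
      (ennreal (4 * M / real N) * sqnorm (invert f) + 2 * (ennreal (real N))\<^sup>2 * osc (invert f))"
    by (intro add_mono local_mass_le N f order_trans[OF mass_outside_le]) measurable
  \<comment> \<open>This fixes the size of \<open>N\<close>: \<open>16 * M <= N\<close> makes both
    coefficients \<open>4 * M / N\<close> at most 1/4, so half of \<open>sqnorm f\<close> is
    absorbed on the left.\<close>
  also have "\<dots> \<le> (ennreal (1 / 4) * sqnorm f + 2 * (ennreal (real N))\<^sup>2 * osc f) +
      (ennreal (1 / 4) * sqnorm f + 2 * (ennreal (real N))\<^sup>2 * osc (invert f))"
    using N M_nonneg by (intro add_mono mult_mono ennreal_leI sqnorm_invert_le f) (auto simp: field_simps)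
  finally have le: "sqnorm f \<le> \<dots>" .
  show ?thesis
  proof (cases "osc f = \<infinity> \<or> osc (invert f) = \<infinity>")
    case True
    then show ?thesis using N by (auto simp: ennreal_mult_eq_top_iff)
  next
    case False
    obtain a where a: "sqnorm f = ennreal a" "0 \<le> a" using fin by (cases "sqnorm f") auto
    obtain b where b: "osc f = ennreal b" "0 \<le> b" using False by (cases "osc f") auto
    obtain c where c: "osc (invert f) = ennreal c" "0 \<le> c" using False by (cases "osc (invert f)") auto
    from le show ?thesis unfolding a(1) b(1) c(1) using a(2) b(2) c(2)
      by (simp add: ennreal_mult[symmetric] ennreal_plus[symmetric] numeral_mult_ennreal power2_eq_square
          del: ennreal_plus) (simp add: algebra_simps)
  qed
qed

section \<open>Contraction of two transfer steps\<close>

lemma transfer_measurable[measurable]: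
  assumes [measurable]: "f \<in> borel_measurable borel"
  shows "transfer E f \<in> borel_measurable borel"
  unfolding transfer_def by measurable

lemma sqnorm_transfer_le:
  assumes [measurable]: "f \<in> borel_measurable borel"
  shows "sqnorm (transfer E f) \<le> sqnorm f"
  unfolding transfer_def by (rule order_trans[OF sqnorm_avg_le sqnorm_invert_le]) measurable

text \<open>One step may lose almost nothing when \<open>invert f\<close> is nearly invariant. But
  then \<open>h = transfer E f\<close> is nearly invariant too, and a second small loss would make
  \<open>invert h\<close> nearly invariant as well, which \<open>sqnorm_le_osc\<close> for
  \<open>h\<close> excludes.\<close>

lemma sqnorm_transfer_twice_le:
  assumes f[measurable]: "f \<in> borel_measurable borel" and fin: "sqnorm f < \<infinity>"
    and N: "N > 0" "16 * M \<le> real N"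
  shows "sqnorm (transfer E (transfer E f))
    \<le> ennreal (8 * (real N)\<^sup>2 / (1 + 8 * (real N)\<^sup>2)) * sqnorm f"
proof -
  define h where "h = transfer E f"
  have h[measurable]: "h \<in> borel_measurable borel" unfolding h_def by measurable
  have finv: "sqnorm (invert f) < \<infinity>" using sqnorm_invert_le[OF f] fin by (rule le_less_trans)
  have hfin: "sqnorm h < \<infinity>" using sqnorm_transfer_le[OF f] fin unfolding h_def by (rule le_less_trans)
  have hinv: "sqnorm (invert h) < \<infinity>" using sqnorm_invert_le[OF h] hfin by (rule le_less_trans)
  have 1: "2 * sqnorm h + osc (invert f) \<le> 2 * sqnorm f"
    using avg_energy_identity[of "invert f" E] finv sqnorm_invert_le[OF f]
    by (simp add: h_def transfer_def mult_left_mono)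
  have 2: "2 * sqnorm (transfer E h) + osc (invert h) \<le> 2 * sqnorm h"
    using avg_energy_identity[of "invert h" E] hinv sqnorm_invert_le[OF h]
    by (simp add: transfer_def mult_left_mono)
  have 3: "osc h \<le> osc (invert f)"
    unfolding h_def transfer_def using finv by (intro osc_avg_le) auto
  have 4: "sqnorm h \<le> ennreal (4 * (real N)\<^sup>2) * (osc (invert f) + osc (invert h))"
    by (rule order_trans[OF sqnorm_le_osc[OF h hfin N]]) (intro mult_left_mono add_right_mono 3, simp)
  have 5: "sqnorm (transfer E h) \<le> sqnorm h" by (rule sqnorm_transfer_le) simp
  have "osc (invert f) < \<infinity>" "osc (invert h) < \<infinity>"
    using 1 2 fin hfin by (auto simp: less_top[symmetric] top_unique ennreal_mult_eq_top_iff)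
  then obtain d e where de: "osc (invert f) = ennreal d" "osc (invert h) = ennreal e" "0 \<le> d" "0 \<le> e"
    by (cases "osc (invert f)"; cases "osc (invert h)") auto
  obtain a b c where abc: "sqnorm f = ennreal a" "sqnorm h = ennreal b" "sqnorm (transfer E h) = ennreal c"
      "0 \<le> a" "0 \<le> b" "0 \<le> c"
    using fin hfin le_less_trans[OF 5 hfin]
    by (cases "sqnorm f"; cases "sqnorm h"; cases "sqnorm (transfer E h)") auto
  note * = abc(1-3) de(1-2) and nn = abc(4-6) de(3-4)
  have r: "2 * b + d \<le> 2 * a" "2 * c + e \<le> 2 * b" "b \<le> 4 * (real N)\<^sup>2 * (d + e)" "c \<le> b"
    using 1 2 4 5 nn unfolding *
    by (simp_all add: ennreal_mult[symmetric] ennreal_plus[symmetric] numeral_mult_ennreal del: ennreal_plus)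
  have "c \<le> 4 * (real N)\<^sup>2 * (d + e)" using r by linarith
  \<comment> \<open>Adding the energy inequalities of the two steps bounds the total oscillation
    \<open>d + e\<close> by twice the total loss \<open>a - c\<close>.\<close>
  also have "\<dots> \<le> 4 * (real N)\<^sup>2 * (2 * a - 2 * c)"
    using r by (intro mult_left_mono) auto
  finally have "c * (1 + 8 * (real N)\<^sup>2) \<le> 8 * (real N)\<^sup>2 * a"
    by (simp add: algebra_simps)
  then have "c \<le> 8 * (real N)\<^sup>2 / (1 + 8 * (real N)\<^sup>2) * a"
    by (simp add: field_simps add_pos_nonneg)
  then show ?thesis
    using nn unfolding h_def[symmetric] * by (simp add: ennreal_mult[symmetric])
qed

end

section \<open>Products of Riccati variables\<close>

text \<open>The ratio of consecutive values of the solution that vanishes just outside the boundary.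
  Once a denominator vanishes, \<open>1 / 0 = 0\<close> breaks this meaning, but for fixed
  potentials that concerns finitely many energies only.\<close>

primrec zeta :: "real \<Rightarrow> (nat \<Rightarrow> real) \<Rightarrow> nat \<Rightarrow> real" where
  "zeta E x 0 = 0"
| "zeta E x (Suc k) = 1 / (E - x k - zeta E x k)"

lemma zeta_cong: "(\<And>i. i < k \<Longrightarrow> x i = y i) \<Longrightarrow> zeta E x k = zeta E y k"
  by (induction k) auto

lemma zeta_measurable:
  assumes [measurable]: "E \<in> borel_measurable M"
    and x: "\<And>i. i < k \<Longrightarrow> (\<lambda>w. x w i) \<in> borel_measurable M"
  shows "(\<lambda>w. zeta (E w) (x w) k) \<in> borel_measurable M"
  using x
proof (induction k)
  case (Suc k)
  have [measurable]: "(\<lambda>w. zeta (E w) (x w) k) \<in> borel_measurable M" "(\<lambda>w. x w k) \<in> borel_measurable M"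
    using Suc by auto
  show ?case by simp
qed simp

context bounded_density
begin

sublocale P: product_prob_space "\<lambda>_ :: int. \<nu>" UNIV
  by unfold_locales

lemma transfer_nonneg:
  assumes "\<And>x. 0 \<le> f x"
  shows "0 \<le> transfer E f z"
  unfolding transfer_def avg_def by (intro integral_nonneg_AE) (auto simp: invert_def assms)

lemma nn_integral_transfer:
  assumes f[measurable]: "f \<in> borel_measurable borel" and nn: "\<And>x. 0 \<le> f x" and fin: "sqnorm f < \<infinity>"
  shows "(\<integral>\<^sup>+v. ennreal (f (1 / (E - v - z)) * \<bar>1 / (E - v - z)\<bar>) \<partial>\<nu>) = ennreal (transfer E f z)"
proof -
  have "integrable \<nu> (\<lambda>v. invert f (E - v - z))"
    using le_less_trans[OF sqnorm_invert_le[OF f] fin] by (intro avg_integrable) auto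
  from nn_integral_eq_integral[OF this] show ?thesis
    by (simp add: transfer_def avg_def invert_def nn)
qed

text \<open>The potential farthest from the boundary \<open>c\<close> enters only the last Riccati
  variable. Integrating it out first replaces \<open>f\<close> by \<open>transfer E f\<close> and
  removes one factor, hence the induction with \<open>f\<close> arbitrary. When no factor is left,
  the other sites cost nothing because \<open>S\<close> bounds the function everywhere.\<close>

lemma expectation_zeta_prod_le:
  fixes c :: int
  assumes "f \<in> borel_measurable borel" "\<And>x. 0 \<le> f x" "sqnorm f < \<infinity>" "d \<le> L"
    and "\<And>z. (transfer E ^^ d) f z \<le> S"
  shows "(\<integral>\<^sup>+V. ennreal (f (zeta E (\<lambda>i. V (c - int i)) L) *
      (\<Prod>k\<in>{L - d<..L}. \<bar>zeta E (\<lambda>i. V (c - int i)) k\<bar>)) \<partial>(\<Pi>\<^sub>M i\<in>{c - int L<..c}. \<nu>)) \<le> ennreal S"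
  using assms
proof (induction d arbitrary: f L)
  case 0
  interpret prob_space "\<Pi>\<^sub>M i\<in>{c - int L<..c}. \<nu>"
    by (intro prob_space_PiM \<nu>.prob_space_axioms)
  have "(\<integral>\<^sup>+V. ennreal (f (zeta E (\<lambda>i. V (c - int i)) L) *
      (\<Prod>k\<in>{L - 0<..L}. \<bar>zeta E (\<lambda>i. V (c - int i)) k\<bar>)) \<partial>(\<Pi>\<^sub>M i\<in>{c - int L<..c}. \<nu>))
    \<le> (\<integral>\<^sup>+V. ennreal S \<partial>(\<Pi>\<^sub>M i\<in>{c - int L<..c}. \<nu>))"
    using 0 by (intro nn_integral_mono ennreal_leI) simp
  then show ?case by (simp add: emeasure_space_1)
next
  case (Suc d)
  then obtain L' where L: "L = Suc L'" by (cases L) auto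
  let ?z = "\<lambda>V k. zeta E (\<lambda>i. V (c - int i)) k"
  let ?I = "{c - int L'<..c}"
  have set: "{c - int L<..c} = insert (c - int L') ?I" and ni: "c - int L' \<notin> ?I"
    unfolding L by auto
  have f[measurable]: "f \<in> borel_measurable borel" by fact
  have mz: "(\<lambda>V. ?z V k) \<in> borel_measurable (\<Pi>\<^sub>M i\<in>{c - int l<..c}. \<nu>)" if "k \<le> l" for k l
    using that by (intro zeta_measurable) auto
  have mz'[measurable]: "(\<lambda>V. ?z V k) \<in> borel_measurable (\<Pi>\<^sub>M i\<in>{c - int L<..c}. \<nu>)" if "k \<in> {L - Suc d<..L}" for k
    using that by (intro mz) auto
  have [measurable]: "(\<lambda>V. ?z V L) \<in> borel_measurable (\<Pi>\<^sub>M i\<in>{c - int L<..c}. \<nu>)"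
    by (rule mz) simp
  have upd: "?z (V(c - int L' := y)) k = ?z V k" if "k \<le> L'" for V y k
    using that by (intro zeta_cong) auto
  have meas: "(\<lambda>V. ennreal (f (?z V L) * (\<Prod>k\<in>{L - Suc d<..L}. \<bar>?z V k\<bar>))) \<in> borel_measurable (\<Pi>\<^sub>M i\<in>{c - int L<..c}. \<nu>)"
    by measurable
  have split: "{L - Suc d<..L} = insert L {L' - d<..L'}"
    unfolding L by auto
  have "(\<integral>\<^sup>+V. ennreal (f (?z V L) * (\<Prod>k\<in>{L - Suc d<..L}. \<bar>?z V k\<bar>)) \<partial>(\<Pi>\<^sub>M i\<in>{c - int L<..c}. \<nu>))
    = (\<integral>\<^sup>+V. \<integral>\<^sup>+y. ennreal (f (?z (V(c - int L' := y)) L) *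
        (\<Prod>k\<in>{L - Suc d<..L}. \<bar>?z (V(c - int L' := y)) k\<bar>)) \<partial>\<nu> \<partial>(\<Pi>\<^sub>M i\<in>?I. \<nu>))"
    unfolding set by (rule P.product_nn_integral_insert) (use ni meas set in auto)
  also have "\<dots> = (\<integral>\<^sup>+V. \<integral>\<^sup>+y. ennreal (f (1 / (E - y - ?z V L')) * \<bar>1 / (E - y - ?z V L')\<bar>) *
        ennreal (\<Prod>k\<in>{L' - d<..L'}. \<bar>?z V k\<bar>) \<partial>\<nu> \<partial>(\<Pi>\<^sub>M i\<in>?I. \<nu>))"
  proof (intro nn_integral_cong)
    fix V y
    have p: "(\<Prod>k\<in>{L' - d<..L'}. \<bar>?z (V(c - int L' := y)) k\<bar>) = (\<Prod>k\<in>{L' - d<..L'}. \<bar>?z V k\<bar>)"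
      by (intro prod.cong refl arg_cong[of _ _ abs] upd) auto
    have zL: "?z (V(c - int L' := y)) L = 1 / (E - y - ?z V L')"
      by (simp add: L upd fun_upd_same del: fun_upd_apply)
    have "(\<Prod>k\<in>{L - Suc d<..L}. \<bar>?z (V(c - int L' := y)) k\<bar>)
        = \<bar>?z (V(c - int L' := y)) L\<bar> * (\<Prod>k\<in>{L' - d<..L'}. \<bar>?z V k\<bar>)"
      unfolding split using L by (subst prod.insert) (auto simp: p simp del: fun_upd_apply)
    then show "ennreal (f (?z (V(c - int L' := y)) L) *
        (\<Prod>k\<in>{L - Suc d<..L}. \<bar>?z (V(c - int L' := y)) k\<bar>)) =
      ennreal (f (1 / (E - y - ?z V L')) * \<bar>1 / (E - y - ?z V L')\<bar>) *
        ennreal (\<Prod>k\<in>{L' - d<..L'}. \<bar>?z V k\<bar>)"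
      unfolding zL using Suc.prems(2) by (subst ennreal_mult[symmetric]) (auto simp: prod_nonneg mult.assoc)
  qed
  also have "\<dots> = (\<integral>\<^sup>+V. ennreal (transfer E f (?z V L')) * ennreal (\<Prod>k\<in>{L' - d<..L'}. \<bar>?z V k\<bar>) \<partial>(\<Pi>\<^sub>M i\<in>?I. \<nu>))"
    using Suc.prems(1-3)
    by (intro nn_integral_cong) (subst nn_integral_multc, measurable, subst nn_integral_transfer, auto)
  also have "\<dots> = (\<integral>\<^sup>+V. ennreal (transfer E f (?z V L') * (\<Prod>k\<in>{L' - d<..L'}. \<bar>?z V k\<bar>)) \<partial>(\<Pi>\<^sub>M i\<in>?I. \<nu>))"
    using Suc.prems(2) by (intro nn_integral_cong) (simp add: ennreal_mult transfer_nonneg prod_nonneg)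
  also have "\<dots> \<le> ennreal S"
  proof (rule Suc.IH)
    show "sqnorm (transfer E f) < \<infinity>"
      using sqnorm_transfer_le[OF f] Suc.prems(3) by (rule le_less_trans)
    show "(transfer E ^^ d) (transfer E f) z \<le> S" for z
      using Suc.prems(5)[of z] by (simp add: funpow_swap1)
  qed (use Suc.prems L in \<open>auto intro: transfer_nonneg\<close>)
  finally show ?case .
qed

lemma sqnorm_iterate_le:
  assumes f[measurable]: "f \<in> borel_measurable borel" and fin: "sqnorm f < \<infinity>"
    and N: "N > 0" "16 * M \<le> real N"
  shows "sqnorm ((transfer E ^^ d) f)
    \<le> ennreal ((8 * (real N)\<^sup>2 / (1 + 8 * (real N)\<^sup>2)) ^ (d div 2)) * sqnorm f"
proof -
  let ?q = "8 * (real N)\<^sup>2 / (1 + 8 * (real N)\<^sup>2)"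
  have q: "0 \<le> ?q" by simp
  have meas[measurable]: "(transfer E ^^ k) f \<in> borel_measurable borel" for k
    by (induction k) auto
  have mono: "sqnorm ((transfer E ^^ k) f) \<le> sqnorm f" for k
    by (induction k) (auto intro: order_trans[OF sqnorm_transfer_le])
  have even: "sqnorm ((transfer E ^^ (2 * k)) f) \<le> ennreal (?q ^ k) * sqnorm f" for k
  proof (induction k)
    case (Suc k)
    have "sqnorm ((transfer E ^^ (2 * Suc k)) f)
        = sqnorm (transfer E (transfer E ((transfer E ^^ (2 * k)) f)))" by simp
    also have "\<dots> \<le> ennreal ?q * sqnorm ((transfer E ^^ (2 * k)) f)"
      using le_less_trans[OF mono fin] by (intro sqnorm_transfer_twice_le N) auto
    also have "\<dots> \<le> ennreal ?q * (ennreal (?q ^ k) * sqnorm f)"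
      by (intro mult_left_mono Suc.IH) simp
    finally show ?case
      by (simp only: power_Suc ennreal_mult[OF q zero_le_power[OF q]] mult.assoc)
  qed simp
  show ?thesis
  proof (cases "even d")
    case True
    then show ?thesis using even[of "d div 2"] by simp
  next
    case False
    then have "(transfer E ^^ d) f = transfer E ((transfer E ^^ (2 * (d div 2))) f)"
      by (metis odd_two_times_div_two_succ Suc_eq_plus1 funpow.simps(2) comp_apply)
    then show ?thesis
      using even[of "d div 2"] order_trans[OF sqnorm_transfer_le] by simp
  qed
qed

end

section \<open>Orthogonal polynomials of a finite Jacobi matrix\<close>

text \<open>The solution at site \<open>k\<close> with values 0 at site 0 and 1 at site 1, where
  site \<open>k + 1\<close> has potential \<open>x k\<close>. Equivalently,
  \<open>jac x (Suc k)\<close> is the characteristic polynomial of the \<open>k\<close> by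
  \<open>k\<close> Jacobi matrix with diagonal \<open>x\<close> and off-diagonal entries 1. Real
  coefficients serve the spectrum, complex ones the counting of roots.\<close>

fun jac :: "(nat \<Rightarrow> 'a :: comm_ring_1) \<Rightarrow> nat \<Rightarrow> 'a poly" where
  "jac x 0 = 0"
| "jac x (Suc 0) = 1"
| "jac x (Suc (Suc k)) = [:- x k, 1:] * jac x (Suc k) - jac x k"

lemma jac_cong: "(\<And>i. Suc i < k \<Longrightarrow> x i = y i) \<Longrightarrow> jac x k = jac y k"
proof (induction k rule: induct_nat_012)
  case (ge2 k)
  have "x k = y k" by (rule ge2.prems) simp
  moreover have "jac x k = jac y k" "jac x (Suc k) = jac y (Suc k)"
    by (rule ge2.IH(1), simp add: ge2.prems) (rule ge2.IH(2), simp add: ge2.prems)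
  ultimately show ?case by simp
qed simp_all

lemma poly_jac_SucSuc: "poly (jac x (Suc (Suc k))) a = (a - x k) * poly (jac x (Suc k)) a - poly (jac x k) a"
  by (simp add: algebra_simps)

lemma jac_degree_lead_coeff:
  fixes x :: "nat \<Rightarrow> 'a :: idom"
  shows "degree (jac x (Suc k)) = k \<and> lead_coeff (jac x (Suc k)) = 1"
proof (induction k rule: less_induct)
  case (less k)
  show ?case
  proof (cases k)
    case (Suc l)
    have l: "degree (jac x (Suc l)) = l" "lead_coeff (jac x (Suc l)) = 1"
      using less[of l] Suc by auto
    then have "jac x (Suc l) \<noteq> 0" by auto
    then have d: "degree ([:- x l, 1:] * jac x (Suc l)) = Suc l"
      by (subst degree_mult_eq) (auto simp: l)
    have dl: "degree (jac x l) < Suc l"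
      using less[of "l - 1"] Suc by (cases l) auto
    have "degree (jac x (Suc (Suc l))) = Suc l"
      using degree_add_eq_left[of "- jac x l" "[:- x l, 1:] * jac x (Suc l)"] d dl by simp
    moreover have "coeff (jac x (Suc (Suc l))) (Suc l) = lead_coeff ([:- x l, 1:] * jac x (Suc l))"
      using coeff_eq_0[OF dl] d by simp
    moreover have "lead_coeff ([:- x l, 1:] * jac x (Suc l)) = 1"
      by (subst lead_coeff_mult) (use l in simp)
    ultimately have "degree (jac x (Suc (Suc l))) = Suc l \<and> coeff (jac x (Suc (Suc l))) (Suc l) = 1"
      by (simp only:)
    then show ?thesis unfolding Suc by (simp only: simp_thms)
  qed simp
qed

lemma jac_nonzero: "jac x (Suc k) \<noteq> (0 :: 'a :: idom poly)"
  using jac_degree_lead_coeff[of x k] by auto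

section \<open>Christoffel-Darboux identities; the spectrum as real simple roots\<close>

text \<open>The source of all the spectral theory here: \<open>b = cnj a\<close> makes the roots
  real, two distinct roots give orthogonality, and the confluent form gives simple roots and the
  derivative of \<open>theta\<close>.\<close>

lemma christoffel_darboux:
  "(a - b) * (\<Sum>k\<le>N. poly (jac x k) a * poly (jac x k) b)
    = poly (jac x (Suc N)) a * poly (jac x N) b - poly (jac x N) a * poly (jac x (Suc N)) b"
proof (induction N)
  case (Suc N)
  have "(a - b) * (\<Sum>k\<le>Suc N. poly (jac x k) a * poly (jac x k) b)
    = poly (jac x (Suc N)) a * poly (jac x N) b - poly (jac x N) a * poly (jac x (Suc N)) b
      + (a - b) * (poly (jac x (Suc N)) a * poly (jac x (Suc N)) b)"
    unfolding sum.atMost_Suc distrib_left Suc.IH by simp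
  then show ?case
    unfolding poly_jac_SucSuc by (simp add: algebra_simps)
qed simp

lemma christoffel_darboux_confluent:
  fixes x :: "nat \<Rightarrow> 'a :: idom"
  shows "(\<Sum>k\<le>N. (poly (jac x k) a)\<^sup>2)
    = poly (pderiv (jac x (Suc N))) a * poly (jac x N) a - poly (pderiv (jac x N)) a * poly (jac x (Suc N)) a"
proof (induction N)
  case (Suc N)
  have D: "poly (pderiv (jac x (Suc (Suc N)))) a
      = poly (jac x (Suc N)) a + (a - x N) * poly (pderiv (jac x (Suc N))) a - poly (pderiv (jac x N)) a"
    by (simp add: pderiv_diff pderiv_add pderiv_smult pderiv_mult pderiv_pCons algebra_simps)
  show ?case
    unfolding sum.atMost_Suc Suc.IH D poly_jac_SucSuc by (simp add: algebra_simps power2_eq_square del: jac.simps)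
qed simp

lemma jac_sum_squares_pos:
  fixes x :: "nat \<Rightarrow> real"
  assumes "N > 0"
  shows "0 < (\<Sum>k\<le>N. (poly (jac x k) a)\<^sup>2)"
proof -
  have "(poly (jac x 1) a)\<^sup>2 \<le> (\<Sum>k\<le>N. (poly (jac x k) a)\<^sup>2)"
    by (rule member_le_sum) (use assms in auto)
  then show ?thesis by simp
qed

lemma poly_jac_of_real:
  "poly (jac (\<lambda>i. complex_of_real (x i)) k) (complex_of_real a) = complex_of_real (poly (jac x k) a)"
  by (induction k rule: induct_nat_012) (simp_all add: poly_jac_SucSuc del: jac.simps(3))

lemma poly_jac_cnj:
  "poly (jac (\<lambda>i. complex_of_real (x i)) k) (cnj z) = cnj (poly (jac (\<lambda>i. complex_of_real (x i)) k) z)"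
  by (induction k rule: induct_nat_012) (simp_all add: poly_jac_SucSuc del: jac.simps(3))

lemma jac_root_real:
  assumes z: "poly (jac (\<lambda>i. complex_of_real (x i)) (Suc N)) z = 0"
  shows "z \<in> \<real>"
proof (cases N)
  case (Suc N')
  let ?q = "\<lambda>k. poly (jac (\<lambda>i. complex_of_real (x i)) k) z"
  have "(z - cnj z) * (\<Sum>k\<le>N. ?q k * cnj (?q k)) = 0"
    using christoffel_darboux[of z "cnj z" "\<lambda>i. complex_of_real (x i)" N] z
    by (simp only: poly_jac_cnj) simp
  moreover have "(\<Sum>k\<le>N. ?q k * cnj (?q k)) = complex_of_real (\<Sum>k\<le>N. (cmod (?q k))\<^sup>2)"
    by (simp only: complex_norm_square of_real_sum)
  moreover have "(cmod (?q 1))\<^sup>2 \<le> (\<Sum>k\<le>N. (cmod (?q k))\<^sup>2)"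
    by (rule member_le_sum) (use Suc in auto)
  then have "(\<Sum>k\<le>N. (cmod (?q k))\<^sup>2) \<noteq> 0" by simp
  ultimately have "z = cnj z"
    by (simp only: mult_eq_0_iff of_real_eq_0_iff) simp
  then show ?thesis by (simp add: Reals_cnj_iff)
qed (use z in simp)

definition spec :: "(nat \<Rightarrow> real) \<Rightarrow> nat \<Rightarrow> real set" where
  "spec x N = {E. poly (jac x (Suc N)) E = 0}"

lemma finite_spec: "finite (spec x N)"
  unfolding spec_def by (rule poly_roots_finite[OF jac_nonzero])

text \<open>Over the complex numbers the polynomial has \<open>N\<close> roots with multiplicity.
  They are real, and simple because at a root the confluent identity factors a positive sum of
  squares through the derivative.\<close>

lemma card_spec: "card (spec x N) = N"
proof -
  let ?p = "jac (\<lambda>i. complex_of_real (x i)) (Suc N)"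
  have roots: "{z. poly ?p z = 0} = complex_of_real ` spec x N"
  proof (intro set_eqI iffI)
    fix z assume "z \<in> {z. poly ?p z = 0}"
    then have z: "poly ?p z = 0" by simp
    from jac_root_real[OF z] obtain E where E: "z = complex_of_real E" by (auto elim: Reals_cases)
    with z show "z \<in> complex_of_real ` spec x N"
      unfolding spec_def by (auto simp only: poly_jac_of_real of_real_eq_0_iff mem_Collect_eq intro!: imageI)
  qed (auto simp only: spec_def poly_jac_of_real of_real_eq_0_iff mem_Collect_eq)
  have "poly (pderiv ?p) z \<noteq> 0" if z: "poly ?p z = 0" for z
  proof -
    obtain E where E: "z = complex_of_real E" "poly (jac x (Suc N)) E = 0"
      using roots z by (auto simp: spec_def)
    then have "N > 0" by (cases N) auto
    from jac_sum_squares_pos[OF this, of x E]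
    have "complex_of_real (\<Sum>k\<le>N. (poly (jac x k) E)\<^sup>2) \<noteq> 0" by (subst of_real_eq_0_iff) simp
    also have "complex_of_real (\<Sum>k\<le>N. (poly (jac x k) E)\<^sup>2)
        = (\<Sum>k\<le>N. (poly (jac (\<lambda>i. complex_of_real (x i)) k) z)\<^sup>2)"
      by (simp only: E poly_jac_of_real of_real_sum of_real_power)
    finally show ?thesis
      unfolding christoffel_darboux_confluent using z by auto
  qed
  then have "rsquarefree ?p"
    unfolding rsquarefree_roots by blast
  then have ord: "order z ?p = (if poly ?p z = 0 then 1 else 0)" for z
  proof -
    have "order z ?p = 0 \<or> order z ?p = 1"
      using \<open>rsquarefree ?p\<close> unfolding rsquarefree_def by blast
    then show ?thesis
      using order_root[of ?p z] jac_nonzero[of "\<lambda>i. complex_of_real (x i)" N]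
      by (cases "poly ?p z = 0"; simp only: if_True if_False; argo)
  qed
  have "finite {z. poly ?p z = 0}" by (rule poly_roots_finite[OF jac_nonzero])
  then have "proots ?p = mset_set {z. poly ?p z = 0}"
    using jac_nonzero[of "\<lambda>i. complex_of_real (x i)" N]
    by (intro multiset_eqI) (simp del: jac.simps add: ord count_mset_set')
  then have "card {z. poly ?p z = 0} = degree ?p"
    using size_proots_complex[of ?p] by simp
  then show ?thesis
    unfolding roots using jac_degree_lead_coeff[of "\<lambda>i. complex_of_real (x i)" N]
    by (subst (asm) card_image) (auto simp: inj_on_def)
qed

text \<open>The degree of \<open>jac x k\<close> is \<open>k - 1\<close>, so the leading terms
  separate; the index 0 is left out because \<open>jac x 0 = 0\<close>.\<close>

lemma jac_independent:
  fixes x :: "nat \<Rightarrow> real"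
  assumes "(\<Sum>k\<le>N. smult (c k) (jac x k)) = 0" "1 \<le> k" "k \<le> N"
  shows "c k = 0"
  using assms
proof (induction N)
  case (Suc N)
  have deg: "degree (jac x j) < N" if "j \<le> N" "N > 0" for j
    using that jac_degree_lead_coeff[of x "j - 1"] by (cases j) auto
  have "coeff (\<Sum>k\<le>N. smult (c k) (jac x k)) N = 0"
  proof (cases "N = 0")
    case False
    then show ?thesis by (auto simp: coeff_sum intro!: sum.neutral coeff_eq_0 deg)
  qed simp
  moreover have lead: "coeff (jac x (Suc N)) N = 1"
    using jac_degree_lead_coeff[of x N] by metis
  moreover have "coeff (\<Sum>k\<le>Suc N. smult (c k) (jac x k)) N = 0"
    using Suc.prems(1) by simp
  ultimately have "c (Suc N) = 0"
    using lead by simp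
  with Suc show ?case by (cases "k = Suc N") auto
qed simp

section \<open>Orthogonality, completeness and bounds on the spectrum\<close>

definition sqsum :: "(nat \<Rightarrow> real) \<Rightarrow> nat \<Rightarrow> real \<Rightarrow> real" where
  "sqsum x N E = (\<Sum>k\<le>N. (poly (jac x k) E)\<^sup>2)"

lemma spec_orthogonal:
  assumes "E \<in> spec x N" "E' \<in> spec x N" "E \<noteq> E'"
  shows "(\<Sum>k\<le>N. poly (jac x k) E * poly (jac x k) E') = 0"
  using christoffel_darboux[of E E' x N] assms by (simp add: spec_def)

text \<open>Orthogonality on the spectrum makes \<open>\<Sum>k. q\<^sub>k(a) q\<^sub>k(E) / sqsum E\<close> the Lagrange basis there;
  expanding \<open>q\<^sub>j\<close> in it and comparing coefficients gives the dual orthogonality.\<close>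

lemma spec_complete:
  assumes ij: "1 \<le> i" "i \<le> N" "1 \<le> j" "j \<le> N"
  shows "(\<Sum>E\<in>spec x N. poly (jac x i) E * poly (jac x j) E / sqsum x N E) = of_bool (i = j)"
proof -
  have N: "N > 0" using ij by auto
  define c where "c k = (\<Sum>E\<in>spec x N. poly (jac x k) E * poly (jac x j) E / sqsum x N E)" for k
  have "poly (jac x j) E = poly (\<Sum>k\<le>N. smult (c k) (jac x k)) E" if E: "E \<in> spec x N" for E
  proof -
    have "poly (\<Sum>k\<le>N. smult (c k) (jac x k)) E
      = (\<Sum>F\<in>spec x N. poly (jac x j) F / sqsum x N F * (\<Sum>k\<le>N. poly (jac x k) E * poly (jac x k) F))"
      unfolding c_def poly_sum poly_smult sum_distrib_left sum_distrib_right
      by (subst sum.swap) (simp add: mult_ac)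
    also have "\<dots> = (\<Sum>F\<in>spec x N. if F = E then poly (jac x j) E else 0)"
      using jac_sum_squares_pos[OF N, of x E]
      by (intro sum.cong refl) (auto simp: spec_orthogonal E sqsum_def power2_eq_square)
    finally show ?thesis using E by (simp add: finite_spec)
  qed
  moreover have deg: "degree (jac x k) < N" if "k \<le> N" for k
    using that N jac_degree_lead_coeff[of x "k - 1"] by (cases k) auto
  moreover have "degree (\<Sum>k\<le>N. smult (c k) (jac x k)) < N"
    using N by (intro degree_sum_less) (auto intro: le_less_trans[OF degree_smult_le] deg)
  ultimately have eq: "jac x j = (\<Sum>k\<le>N. smult (c k) (jac x k))"
    using ij by (intro poly_eqI_degree[of "spec x N"]) (auto simp: card_spec)
  have "(\<Sum>k\<le>N. smult (c k - of_bool (k = j)) (jac x k))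
      = (\<Sum>k\<le>N. smult (c k) (jac x k)) - (\<Sum>k\<le>N. smult (of_bool (k = j)) (jac x k))"
    by (simp add: smult_diff_left sum_subtractf)
  also have "(\<Sum>k\<le>N. smult (of_bool (k = j)) (jac x k)) = (\<Sum>k\<le>N. if k = j then jac x j else 0)"
    by (intro sum.cong) auto
  also have "\<dots> = jac x j" using ij by simp
  finally have "(\<Sum>k\<le>N. smult (c k - of_bool (k = j)) (jac x k)) = 0"
    using eq by simp
  from jac_independent[OF this ij(1,2)] show ?thesis by (simp add: c_def)
qed

text \<open>Evaluate the eigenvalue equation where the eigenfunction has maximal modulus. The
  maximum is at least 1, by the value at site 1, so it is not taken at the two boundary sites, where
  the eigenfunction vanishes.\<close>

lemma spec_bounded:
  assumes E: "E \<in> spec x N" and x: "\<And>i. i < N \<Longrightarrow> \<bar>x i\<bar> \<le> B"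
  shows "\<bar>E\<bar> \<le> B + 2"
proof -
  let ?q = "\<lambda>k. \<bar>poly (jac x k) E\<bar>"
  obtain k where k: "k \<in> {..Suc N}" and max': "Max (?q ` {..Suc N}) = ?q k"
    by (rule obtains_MAX[of "{..Suc N}" ?q]) auto
  have max: "?q j \<le> ?q k" if "j \<le> Suc N" for j
    using Max_ge[of "?q ` {..Suc N}" "?q j"] that unfolding max' by simp
  have pos: "1 \<le> ?q k" using max[of 1] by simp
  have "k \<noteq> 0" using pos by (intro notI) simp
  moreover have "k \<noteq> Suc N" using pos E by (intro notI) (simp add: spec_def del: jac.simps)
  ultimately
  obtain i where i: "k = Suc i" "i < N" using k by (cases k) auto
  have "E * poly (jac x k) E = poly (jac x (Suc k)) E + x i * poly (jac x k) E + poly (jac x i) E"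
    unfolding i poly_jac_SucSuc by (simp add: algebra_simps)
  then have "\<bar>E\<bar> * ?q k = \<bar>poly (jac x (Suc k)) E + x i * poly (jac x k) E + poly (jac x i) E\<bar>"
    by (simp add: abs_mult[symmetric])
  also have "\<dots> \<le> ?q (Suc k) + \<bar>x i\<bar> * ?q k + ?q i"
    unfolding abs_mult[symmetric] by linarith
  also have "\<dots> \<le> ?q k + B * ?q k + ?q k"
    using x[OF i(2)] i by (intro add_mono mult_right_mono max) auto
  finally have "\<bar>E\<bar> * ?q k \<le> (B + 2) * ?q k" by (simp add: algebra_simps)
  then show ?thesis using mult_right_le_imp_le[of "\<bar>E\<bar>" "?q k" "B + 2"] pos by linarith
qed

section \<open>Spectral representation on a box\<close>

text \<open>\<open>hop \<omega> J n k j\<close> is the entry \<open>(j, n)\<close> of the \<open>k\<close>-th power of the Schroedinger operator restricted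
  to \<open>J\<close>, and \<open>amp\<close> below that of its evolution; \<open>J = UNIV\<close> gives the operator on the line.\<close>

primrec hop :: "(int \<Rightarrow> real) \<Rightarrow> int set \<Rightarrow> int \<Rightarrow> nat \<Rightarrow> int \<Rightarrow> real" where
  "hop \<omega> J n 0 j = of_bool (j = n)"
| "hop \<omega> J n (Suc k) j =
    (if j \<in> J then hop \<omega> J n k (j + 1) + hop \<omega> J n k (j - 1) + \<omega> j * hop \<omega> J n k j else 0)"

text \<open>The sites 0 and \<open>Suc N\<close> just outside the box are included so that the
  induction can use both neighbours of every site; both sides vanish there.\<close>

lemma hop_spectral:
  assumes x: "x = (\<lambda>i. \<omega> (b + 1 + int i))" and j: "1 \<le> j" "j \<le> N" and i: "i \<le> Suc N"
  shows "hop \<omega> {b<..b + int N} (b + int j) k (b + int i)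
    = (\<Sum>E\<in>spec x N. E ^ k * (poly (jac x i) E * poly (jac x j) E / sqsum x N E))"
  using i
proof (induction k arbitrary: i)
  case 0
  consider "i = 0" | "i = Suc N" | "1 \<le> i" "i \<le> N" using 0 by linarith
  then show ?case
  proof cases
    case 2
    then show ?thesis using j by (auto simp: spec_def simp del: jac.simps intro!: sum.neutral[symmetric])
  qed (use j in \<open>auto simp: spec_complete\<close>)
next
  case (Suc k)
  let ?c = "\<lambda>i E. E ^ k * (poly (jac x i) E * poly (jac x j) E / sqsum x N E)"
  consider "i = 0" | "i = Suc N" | l where "i = Suc l" "l < N" using Suc.prems by (cases i) force+
  then show ?case
  proof cases
    case 2
    then show ?thesis by (auto simp: spec_def simp del: jac.simps intro!: sum.neutral[symmetric])
  next
    case 3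
    have xl: "\<omega> (b + int i) = x l" by (simp add: x 3 algebra_simps)
    have "hop \<omega> {b<..b + int N} (b + int j) (Suc k) (b + int i)
      = (\<Sum>E\<in>spec x N. ?c (Suc (Suc l)) E) + (\<Sum>E\<in>spec x N. ?c l E) + x l * (\<Sum>E\<in>spec x N. ?c (Suc l) E)"
      using 3 Suc.IH[of "Suc (Suc l)"] Suc.IH[of l] Suc.IH[of "Suc l"] xl
      by (simp add: algebra_simps del: jac.simps)
    also have "\<dots> = (\<Sum>E\<in>spec x N. ?c (Suc (Suc l)) E + ?c l E + x l * ?c (Suc l) E)"
      by (simp only: sum.distrib sum_distrib_left)
    also have "\<dots> = (\<Sum>E\<in>spec x N. E ^ Suc k * (poly (jac x i) E * poly (jac x j) E / sqsum x N E))"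
      unfolding 3 poly_jac_SucSuc
      by (intro sum.cong refl) (simp add: algebra_simps diff_divide_distrib add_divide_distrib del: jac.simps)
    finally show ?thesis .
  qed simp
qed

definition amp :: "(int \<Rightarrow> real) \<Rightarrow> int set \<Rightarrow> int \<Rightarrow> int \<Rightarrow> real \<Rightarrow> complex" where
  "amp \<omega> J m n t = (\<Sum>k. ((- (\<i> * complex_of_real t)) ^ k /\<^sub>R fact k) * complex_of_real (hop \<omega> J n k m))"

lemma amp_spectral:
  assumes x: "x = (\<lambda>i. \<omega> (b + 1 + int i))" and ij: "1 \<le> j" "j \<le> N" "i \<le> Suc N"
  shows "amp \<omega> {b<..b + int N} (b + int i) (b + int j) t
    = (\<Sum>E\<in>spec x N. exp (- (\<i> * complex_of_real t) * complex_of_real E) *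
        complex_of_real (poly (jac x i) E * poly (jac x j) E / sqsum x N E))"
proof -
  let ?c = "\<lambda>E. poly (jac x i) E * poly (jac x j) E / sqsum x N E"
  let ?z = "- (\<i> * complex_of_real t)"
  have "(\<lambda>k. \<Sum>E\<in>spec x N. ((?z * complex_of_real E) ^ k /\<^sub>R fact k) * complex_of_real (?c E)) sums
      (\<Sum>E\<in>spec x N. exp (?z * complex_of_real E) * complex_of_real (?c E))"
    by (intro sums_sum sums_mult2 exp_converges)
  also have "(\<lambda>k. \<Sum>E\<in>spec x N. ((?z * complex_of_real E) ^ k /\<^sub>R fact k) * complex_of_real (?c E))
      = (\<lambda>k. (?z ^ k /\<^sub>R fact k) * complex_of_real (hop \<omega> {b<..b + int N} (b + int j) k (b + int i)))"
    unfolding hop_spectral[OF x ij] of_real_sum sum_distrib_left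
    by (intro ext sum.cong refl) (simp only: power_mult_distrib of_real_mult of_real_power mult_ac scaleR_conv_of_real)
  finally show ?thesis
    unfolding amp_def by (rule sums_unique[symmetric])
qed

section \<open>The eigenvalue equation solved for the middle potential\<close>

text \<open>At an eigenvalue the solutions from the two ends are proportional. The factor is the
  left solution at site \<open>N\<close>, where the right one equals 1.\<close>

lemma right_solution:
  assumes E: "E \<in> spec x N" and i: "i \<le> Suc N"
  shows "poly (jac x (Suc N - i)) E = poly (jac x N) E * poly (jac (\<lambda>i. x (N - 1 - i)) i) E"
  using i
proof (induction i rule: induct_nat_012)
  case 0
  then show ?case using E by (simp add: spec_def del: jac.simps(3))
next
  case (ge2 i)
  then obtain k where k: "N = Suc (i + k)" by (auto simp: le_iff_add)
  have "Suc N - i = Suc (Suc k)" "Suc N - Suc i = Suc k" "Suc N - Suc (Suc i) = k" "N - 1 - i = k"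
    unfolding k by auto
  note eqs = this
  let ?w = "jac (\<lambda>i. x (N - 1 - i))"
  have "poly (jac x k) E = (E - x k) * poly (jac x (Suc k)) E - poly (jac x (Suc (Suc k))) E"
    using poly_jac_SucSuc[of x k E] by (simp del: jac.simps)
  also have "\<dots> = (E - x k) * (poly (jac x N) E * poly (?w (Suc i)) E) - poly (jac x N) E * poly (?w i) E"
    using ge2 by (simp only: eqs)
  also have "\<dots> = poly (jac x N) E * poly (?w (Suc (Suc i))) E"
    unfolding poly_jac_SucSuc[of "\<lambda>i. x (N - 1 - i)"] eqs by (simp add: algebra_simps del: jac.simps)
  finally show ?case by (simp only: eqs)
qed simp

text \<open>Regular energies with \<open>theta = v\<close> are the eigenvalues, with eigenfunction nonzero at the middle,
  of the box with middle site potential \<open>v\<close>, left potentials \<open>x\<close> and right potentials \<open>y\<close> (both listed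
  from the boundary inwards); \<open>dtheta\<close> is the derivative of \<open>theta\<close>.\<close>

definition theta :: "(nat \<Rightarrow> real) \<Rightarrow> (nat \<Rightarrow> real) \<Rightarrow> nat \<Rightarrow> real \<Rightarrow> real" where
  "theta x y L E = E - poly (jac x L) E / poly (jac x (Suc L)) E - poly (jac y L) E / poly (jac y (Suc L)) E"

definition dtheta :: "(nat \<Rightarrow> real) \<Rightarrow> (nat \<Rightarrow> real) \<Rightarrow> nat \<Rightarrow> real \<Rightarrow> real" where
  "dtheta x y L E = 1 + sqsum x L E / (poly (jac x (Suc L)) E)\<^sup>2 + sqsum y L E / (poly (jac y (Suc L)) E)\<^sup>2"

definition regular :: "(nat \<Rightarrow> real) \<Rightarrow> (nat \<Rightarrow> real) \<Rightarrow> nat \<Rightarrow> real \<Rightarrow> bool" where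
  "regular x y L E \<longleftrightarrow> poly (jac x (Suc L)) E \<noteq> 0 \<and> poly (jac y (Suc L)) E \<noteq> 0"

text \<open>The middle site has number \<open>Suc L\<close> and potential \<open>x L\<close>. The
  equation there, divided by the value of the eigenfunction, gives \<open>theta\<close>. Dividing
  the squared norm by the squared middle value gives \<open>dtheta\<close>: the summands are the
  middle site and the two halves.\<close>

lemma eigenfunction_at_middle:
  fixes x :: "nat \<Rightarrow> real" and L d :: nat
  defines "y \<equiv> \<lambda>i. x (2 * L - i)"
  assumes E: "E \<in> spec x (2 * L + 1)" and nz: "poly (jac x (Suc L)) E \<noteq> 0" and d: "d \<le> L"
  shows "regular x y L E" and "theta x y L E = x L"
    and "\<bar>poly (jac x (Suc L)) E * poly (jac x (Suc L + d)) E / sqsum x (2 * L + 1) E\<bar>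
      = \<bar>poly (jac y (Suc L - d)) E / poly (jac y (Suc L)) E\<bar> / dtheta x y L E"
proof -
  define c where "c = poly (jac x (2 * L + 1)) E"
  have rs: "poly (jac x (2 * L + 2 - i)) E = c * poly (jac y i) E" if "i \<le> 2 * L + 2" for i
    using right_solution[OF E, of i] that unfolding c_def y_def by (simp del: jac.simps)
  have m: "poly (jac x (Suc L)) E = c * poly (jac y (Suc L)) E"
    using rs[of "Suc L"] by (simp del: jac.simps)
  with nz have c: "c \<noteq> 0" and ynz: "poly (jac y (Suc L)) E \<noteq> 0" by auto
  then show "regular x y L E" using nz by (simp add: regular_def)
  have "(E - x L) * poly (jac x (Suc L)) E - poly (jac x L) E = c * poly (jac y L) E"
    using rs[of L] poly_jac_SucSuc[of x L E] by (simp del: jac.simps)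
  then have "E - x L = poly (jac x L) E / poly (jac x (Suc L)) E + c * poly (jac y L) E / poly (jac x (Suc L)) E"
    using nz by (simp add: field_simps del: jac.simps)
  then show "theta x y L E = x L"
    unfolding theta_def using c by (simp add: m del: jac.simps)
  let ?q = "\<lambda>k. poly (jac x k) E" and ?p = "\<lambda>k. poly (jac y k) E"
  have "sqsum x (2 * L + 1) E = (\<Sum>k\<le>L. (?q k)\<^sup>2) + (\<Sum>k\<in>{Suc L..2 * L + 1}. (?q k)\<^sup>2)"
  proof -
    have "{..2 * L + 1} = {..L} \<union> {Suc L..2 * L + 1}" by auto
    then show ?thesis
      unfolding sqsum_def by (simp only:) (rule sum.union_disjoint, auto)
  qed
  also have "(\<Sum>k\<in>{Suc L..2 * L + 1}. (?q k)\<^sup>2) = (\<Sum>i\<in>{1..Suc L}. (?q (2 * L + 2 - i))\<^sup>2)"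
    by (rule sum.reindex_bij_witness[of _ "\<lambda>i. 2 * L + 2 - i" "\<lambda>i. 2 * L + 2 - i"]) auto
  also have "\<dots> = (\<Sum>i\<in>{1..Suc L}. c\<^sup>2 * (?p i)\<^sup>2)"
    by (intro sum.cong refl) (subst rs, simp, simp only: power_mult_distrib)
  \<comment> \<open>Index 0 is free since \<open>jac y 0 = 0\<close>. The top index
    \<open>Suc L\<close> is the middle site, which becomes the 1 in \<open>dtheta\<close>.\<close>
  also have "\<dots> = (\<Sum>i\<le>Suc L. c\<^sup>2 * (?p i)\<^sup>2)"
    by (rule sum.mono_neutral_left) (auto simp: not_le)
  also have "\<dots> = c\<^sup>2 * sqsum y L E + c\<^sup>2 * (?p (Suc L))\<^sup>2"
    by (simp add: sqsum_def sum_distrib_left)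
  also have "(\<Sum>k\<le>L. (?q k)\<^sup>2) = sqsum x L E" by (simp add: sqsum_def)
  finally have "sqsum x (2 * L + 1) E = (?q (Suc L))\<^sup>2 * dtheta x y L E"
    unfolding dtheta_def using c ynz by (simp add: m field_simps power_mult_distrib del: jac.simps)
  moreover have "?q (Suc L + d) = c * ?p (Suc L - d)"
    using rs[of "Suc L - d"] d by (simp add: algebra_simps Suc_diff_le del: jac.simps)
  moreover have "dtheta x y L E > 0"
    unfolding dtheta_def sqsum_def by (intro add_pos_nonneg divide_nonneg_nonneg sum_nonneg) auto
  ultimately show "\<bar>?q (Suc L) * ?q (Suc L + d) / sqsum x (2 * L + 1) E\<bar>
      = \<bar>?p (Suc L - d) / ?p (Suc L)\<bar> / dtheta x y L E"
    using c ynz by (simp add: m abs_mult power2_eq_square del: jac.simps)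
qed

lemma dtheta_ge_1: "1 \<le> dtheta x y L E"
proof -
  have "0 \<le> sqsum x L E / (poly (jac x (Suc L)) E)\<^sup>2 + sqsum y L E / (poly (jac y (Suc L)) E)\<^sup>2"
    unfolding sqsum_def by (intro add_nonneg_nonneg divide_nonneg_nonneg sum_nonneg) auto
  then show ?thesis unfolding dtheta_def by simp
qed

lemma jac_ratio_deriv:
  assumes "poly (jac x (Suc L)) E \<noteq> 0"
  shows "((\<lambda>E. poly (jac x L) E / poly (jac x (Suc L)) E) has_field_derivative
    - (sqsum x L E / (poly (jac x (Suc L)) E)\<^sup>2)) (at E)"
proof -
  have "((\<lambda>E. poly (jac x L) E / poly (jac x (Suc L)) E) has_field_derivative
    (poly (pderiv (jac x L)) E * poly (jac x (Suc L)) E - poly (jac x L) E * poly (pderiv (jac x (Suc L))) E)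
      / (poly (jac x (Suc L)) E * poly (jac x (Suc L)) E)) (at E)"
    by (intro DERIV_divide poly_DERIV assms)
  moreover have "poly (pderiv (jac x L)) E * poly (jac x (Suc L)) E - poly (jac x L) E * poly (pderiv (jac x (Suc L))) E
      = - sqsum x L E"
    unfolding sqsum_def christoffel_darboux_confluent by (simp add: algebra_simps del: jac.simps)
  ultimately show ?thesis by (simp add: power2_eq_square del: jac.simps)
qed

lemma theta_deriv:
  assumes "regular x y L E"
  shows "(theta x y L has_field_derivative dtheta x y L E) (at E)"
proof -
  have "(theta x y L has_field_derivative 1 - - (sqsum x L E / (poly (jac x (Suc L)) E)\<^sup>2)
      - - (sqsum y L E / (poly (jac y (Suc L)) E)\<^sup>2)) (at E)"
    unfolding theta_def[abs_def] using assms unfolding regular_def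
    by (intro DERIV_diff DERIV_ident jac_ratio_deriv) auto
  then show ?thesis by (simp add: dtheta_def del: jac.simps)
qed

lemma finite_not_regular: "finite {E. \<not> regular x y L E}"
proof -
  have "{E. \<not> regular x y L E} = {E. poly (jac x (Suc L)) E = 0} \<union> {E. poly (jac y (Suc L)) E = 0}"
    by (auto simp: regular_def)
  then show ?thesis by (simp add: poly_roots_finite[OF jac_nonzero])
qed

lemma theta_strict_mono:
  assumes "E < E'" "\<And>F. E \<le> F \<Longrightarrow> F \<le> E' \<Longrightarrow> regular x y L F"
  shows "theta x y L E < theta x y L E'"
proof (rule DERIV_pos_imp_increasing[OF assms(1)])
  fix F assume "E \<le> F" "F \<le> E'"
  then show "\<exists>z. (theta x y L has_real_derivative z) (at F) \<and> 0 < z"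
    using theta_deriv[OF assms(2)] dtheta_ge_1[of x y L F] by force
qed

section \<open>Spectral averaging over one site\<close>

lemma poly_borel_measurable[measurable]: "poly p \<in> borel_measurable (borel :: real measure)"
  by (intro borel_measurable_continuous_onI continuous_on_poly continuous_on_id)

lemma theta_measurable[measurable]: "theta x y L \<in> borel_measurable borel"
  unfolding theta_def[abs_def] by measurable

lemma dtheta_measurable[measurable]: "dtheta x y L \<in> borel_measurable borel"
  unfolding dtheta_def[abs_def] sqsum_def by measurable

text \<open>Between singularities \<open>theta\<close> is strictly increasing, so each such piece
  holds at most one eigenvalue for a given \<open>v\<close>. On a piece, \<open>v = theta E\<close>
  is a change of variables whose Jacobian cancels the weight \<open>1 / dtheta\<close>. The sum over
  \<open>A v\<close> only dominates the measurable \<open>X\<close>, since its own dependence on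
  \<open>v\<close> is not controlled.\<close>

lemma spectral_averaging:
  fixes r g :: "real \<Rightarrow> real" and A :: "real \<Rightarrow> real set" and X :: "real \<Rightarrow> ennreal"
  assumes [measurable]: "r \<in> borel_measurable borel" "g \<in> borel_measurable borel" "X \<in> borel_measurable borel"
    and r: "\<And>v. 0 \<le> r v" and g: "\<And>E. 0 \<le> g E"
    and finA: "\<And>v. finite (A v)"
    and A: "\<And>v E. E \<in> A v \<Longrightarrow> regular x y L E \<and> \<bar>E\<bar> \<le> R \<and> theta x y L E = v"
    and X: "\<And>v. X v \<le> ennreal (r v * (\<Sum>E\<in>A v. g E / dtheta x y L E))"
  shows "(\<integral>\<^sup>+v. X v \<partial>lborel) \<le> (\<integral>\<^sup>+E. indicator {-R..R} E * ennreal (r (theta x y L E) * g E) \<partial>lborel)"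
    (is "_ \<le> ?R")
proof (cases "?R < \<infinity>")
  case fin: True
  define Z where "Z = {E. \<not> regular x y L E}"
  \<comment> \<open>The label of the piece: regular energies with equal \<open>k\<close> have no
    singular energy between them.\<close>
  define k where "k E = card {z \<in> Z. z < E}" for E
  define S where "S i = {E. regular x y L E \<and> \<bar>E\<bar> \<le> R \<and> k E = i}" for i
  define h where "h E = g E / dtheta x y L E" for E
  define f where "f i v = r v * h (the_inv_into (S i) (theta x y L) v)" for i v
  have Z: "finite Z" unfolding Z_def by (rule finite_not_regular)
  have k_le: "k E \<le> card Z" for E
    unfolding k_def by (rule card_mono) (auto simp: Z)
  have h_nonneg: "0 \<le> h E" for E
    unfolding h_def using g dtheta_ge_1[of x y L E] by auto
  have less: "theta x y L E < theta x y L E'" if "E \<in> S i" "E' \<in> S i" "E < E'" for E E' i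
  proof (rule theta_strict_mono[OF that(3)])
    fix F assume F: "E \<le> F" "F \<le> E'"
    show "regular x y L F"
    proof (rule ccontr)
      assume nr: "\<not> regular x y L F"
      then have "F \<noteq> E" "F \<noteq> E'" using that by (auto simp: S_def)
      with nr F have "F \<in> {z \<in> Z. z < E'}" "F \<notin> {z \<in> Z. z < E}" by (auto simp: Z_def)
      moreover have "{z \<in> Z. z < E} \<subseteq> {z \<in> Z. z < E'}" using that(3) by auto
      ultimately have "k E < k E'"
        unfolding k_def by (intro psubset_card_mono) (auto simp: Z)
      then show False using that by (simp add: S_def)
    qed
  qed
  have inj: "inj_on (theta x y L) (S i)" for i
    by (rule inj_onI) (metis less less_irrefl linorder_neqE_linordered_idom)
  have k_eq: "real (k E) = (\<Sum>z\<in>Z. of_bool (z < E))" for E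
    unfolding k_def using Z by (simp add: sum_of_bool_eq Int_def conj_commute)
  have [measurable]: "(\<lambda>E. real (k E)) \<in> borel_measurable borel"
    unfolding k_eq of_bool_def by measurable
  have "S i = {E. \<bar>E\<bar> \<le> R \<and> real (k E) = real i} - Z" for i
    by (auto simp: S_def Z_def)
  moreover have "Z \<in> sets borel" using Z by (intro borel_closed finite_imp_closed)
  moreover have "{E. \<bar>E\<bar> \<le> R \<and> real (k E) = real i} \<in> sets borel" for i by measurable
  ultimately have [measurable]: "S i \<in> sets borel" for i by (simp only: sets.Diff)
  have on_S: "indicator (S i) E * (\<bar>dtheta x y L E\<bar> * f i (theta x y L E))
      = indicator (S i) E * (r (theta x y L E) * g E)" for i E
    using dtheta_ge_1[of x y L E] the_inv_into_f_f[OF inj, of E i]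
    by (auto simp: indicator_def f_def h_def)
  have [measurable]: "(\<lambda>E. indicator (S i) E * (\<bar>dtheta x y L E\<bar> * f i (theta x y L E))) \<in> borel_measurable borel" for i
    unfolding on_S by measurable
  have "(\<Sum>i\<le>card Z. \<integral>\<^sup>+E. ennreal (indicator (S i) E * (r (theta x y L E) * g E)) \<partial>lborel)
      = (\<integral>\<^sup>+E. (\<Sum>i\<le>card Z. ennreal (indicator (S i) E * (r (theta x y L E) * g E))) \<partial>lborel)"
    by (rule nn_integral_sum[symmetric]) measurable
  also have "\<dots> \<le> ?R"
  proof (rule nn_integral_mono)
    fix E
    have "(\<Sum>i\<le>card Z. ennreal (indicator (S i) E * (r (theta x y L E) * g E)))
        = (\<Sum>i\<le>card Z. if i = k E then ennreal (indicator (S (k E)) E * (r (theta x y L E) * g E)) else 0)"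
      by (intro sum.cong refl) (auto simp: S_def indicator_def)
    also have "\<dots> = ennreal (indicator (S (k E)) E * (r (theta x y L E) * g E))"
      using k_le by simp
    also have "\<dots> \<le> indicator {-R..R} E * ennreal (r (theta x y L E) * g E)"
      by (auto simp: indicator_def S_def)
    finally show "(\<Sum>i\<le>card Z. ennreal (indicator (S i) E * (r (theta x y L E) * g E)))
      \<le> indicator {-R..R} E * ennreal (r (theta x y L E) * g E)" .
  qed
  finally have sum_le: "(\<Sum>i\<le>card Z. \<integral>\<^sup>+E. ennreal (indicator (S i) E * (r (theta x y L E) * g E)) \<partial>lborel) \<le> ?R" .
  have fin_i: "(\<integral>\<^sup>+E. ennreal (indicator (S i) E * (\<bar>dtheta x y L E\<bar> * f i (theta x y L E))) \<partial>lborel) < \<infinity>"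
    if "i \<le> card Z" for i
    unfolding on_S
    by (rule le_less_trans[OF order_trans[OF member_le_sum sum_le] fin]) (use that in auto)
  have der: "(theta x y L has_field_derivative dtheta x y L E) (at E within S i)" if "E \<in> S i" for E i
    using theta_deriv[of x y L E] that by (auto simp: S_def intro: has_field_derivative_at_within)
  have f_nonneg: "0 \<le> f i v" for i v
    unfolding f_def using r h_nonneg by simp
  have "X v \<le> (\<Sum>i\<le>card Z. ennreal (indicator (theta x y L ` S i) v * f i v))" for v
  proof -
    have piece: "(\<Sum>E\<in>{E \<in> A v. k E = i}. h E)
        \<le> indicator (theta x y L ` S i) v * h (the_inv_into (S i) (theta x y L) v)" for i
    proof (cases "v \<in> theta x y L ` S i")
      case True
      then obtain E where E: "E \<in> S i" "theta x y L E = v" by auto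
      have "{E \<in> A v. k E = i} \<subseteq> {E}"
        using inj[of i] E A by (auto simp: S_def inj_on_def)
      then have "(\<Sum>E\<in>{E \<in> A v. k E = i}. h E) \<le> (\<Sum>E\<in>{E}. h E)"
        by (intro sum_mono2) (auto simp: h_nonneg)
      then show ?thesis using True the_inv_into_f_f[OF inj E(1)] E(2) by simp
    next
      case False
      then have "{E \<in> A v. k E = i} = {}" using A by (auto simp: S_def)
      then show ?thesis using False by (simp only:) simp
    qed
    have "(\<Sum>E\<in>A v. h E) = (\<Sum>i\<le>card Z. \<Sum>E\<in>{E \<in> A v. k E = i}. h E)"
      using finA k_le by (intro sum.group[symmetric]) auto
    also have "\<dots> \<le> (\<Sum>i\<le>card Z. indicator (theta x y L ` S i) v * h (the_inv_into (S i) (theta x y L) v))"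
      by (intro sum_mono piece)
    finally have "r v * (\<Sum>E\<in>A v. h E)
        \<le> r v * (\<Sum>i\<le>card Z. indicator (theta x y L ` S i) v * h (the_inv_into (S i) (theta x y L) v))"
      by (rule mult_left_mono[OF _ r])
    also have "\<dots> = (\<Sum>i\<le>card Z. indicator (theta x y L ` S i) v * f i v)"
      by (simp only: sum_distrib_left f_def mult_ac)
    finally have "X v \<le> ennreal (\<Sum>i\<le>card Z. indicator (theta x y L ` S i) v * f i v)"
      using X[of v] unfolding h_def by (meson ennreal_leI order_trans)
    then show ?thesis
      using f_nonneg by (simp add: sum_ennreal)
  qed
  \<comment> \<open>The estimate is made under \<open>lebesgue\<close> because the functions on the
    images of the pieces are only known to be Lebesgue measurable.\<close>
  then have "(\<integral>\<^sup>+v. X v \<partial>lebesgue)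
      \<le> (\<integral>\<^sup>+v. (\<Sum>i\<le>card Z. ennreal (indicator (theta x y L ` S i) v * f i v)) \<partial>lebesgue)"
    by (intro nn_integral_mono)
  also have "\<dots> = (\<Sum>i\<le>card Z. \<integral>\<^sup>+v. ennreal (indicator (theta x y L ` S i) v * f i v) \<partial>lebesgue)"
    by (intro nn_integral_sum measurable_compose[OF _ measurable_ennreal]
        measurable_on_image[where g' = "dtheta x y L"] der inj f_nonneg fin_i) auto
  also have "\<dots> = (\<Sum>i\<le>card Z. \<integral>\<^sup>+E. ennreal (indicator (S i) E * (\<bar>dtheta x y L E\<bar> * f i (theta x y L E))) \<partial>lborel)"
    by (intro sum.cong refl nn_integral_on_image der inj f_nonneg fin_i) auto
  also have "\<dots> \<le> ?R" unfolding on_S by (rule sum_le)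
  also have "(\<integral>\<^sup>+v. X v \<partial>lebesgue) = (\<integral>\<^sup>+v. X v \<partial>lborel)"
    by (rule nn_integral_completion) measurable
  finally show ?thesis .
qed (simp add: not_less top_unique)

section \<open>Localization in a box\<close>

lemma zeta_jac:
  assumes "\<And>k. k < i \<Longrightarrow> poly (jac x (Suc k)) E \<noteq> 0"
  shows "zeta E x i = poly (jac x i) E / poly (jac x (Suc i)) E"
  using assms
proof (induction i)
  case (Suc i)
  have nz: "poly (jac x (Suc i)) E \<noteq> 0" by (rule Suc.prems) simp
  have "zeta E x (Suc i) = 1 / (E - x i - poly (jac x i) E / poly (jac x (Suc i)) E)"
    using Suc by simp
  also have "E - x i - poly (jac x i) E / poly (jac x (Suc i)) E
      = poly (jac x (Suc (Suc i))) E / poly (jac x (Suc i)) E"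
    unfolding poly_jac_SucSuc using nz by (simp add: field_simps del: jac.simps)
  finally show ?case by simp
qed simp

text \<open>The product of ratios telescopes to the ratio of the solution at distance
  \<open>d\<close> from the middle to that at the middle.\<close>

lemma prod_zeta_jac:
  assumes "\<And>k. k \<le> L \<Longrightarrow> poly (jac x (Suc k)) E \<noteq> 0" and "d \<le> L"
  shows "(\<Prod>k\<in>{L - d<..L}. \<bar>zeta E x k\<bar>) = \<bar>poly (jac x (Suc L - d)) E / poly (jac x (Suc L)) E\<bar>"
  using assms(2)
proof (induction d)
  case 0
  then show ?case using assms(1)[of L] by (simp del: jac.simps)
next
  case (Suc d)
  have "{L - Suc d<..L} = insert (L - d) {L - d<..L}" using Suc.prems by auto
  then have "(\<Prod>k\<in>{L - Suc d<..L}. \<bar>zeta E x k\<bar>) = \<bar>zeta E x (L - d)\<bar> * (\<Prod>k\<in>{L - d<..L}. \<bar>zeta E x k\<bar>)"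
    by simp
  also have "zeta E x (L - d) = poly (jac x (L - d)) E / poly (jac x (Suc L - d)) E"
    using Suc.prems assms(1) by (subst zeta_jac) (auto simp: Suc_diff_le simp del: jac.simps)
  finally show ?case
    using Suc assms(1)[of "L - d"] by (simp add: abs_mult Suc_diff_le del: jac.simps)
qed

lemma hop_measurable:
  assumes "\<And>j. j \<in> J \<Longrightarrow> (\<lambda>w. f w j) \<in> borel_measurable M"
  shows "(\<lambda>w. hop (f w) J n k j) \<in> borel_measurable M"
proof (induction k arbitrary: j)
  case (Suc k)
  show ?case
  proof (cases "j \<in> J")
    case True
    have [measurable]: "(\<lambda>w. f w j) \<in> borel_measurable M" using assms True .
    note Suc[measurable]
    show ?thesis using True by simp
  qed simp
qed simp

lemma amp_measurable:
  assumes "\<And>j. j \<in> J \<Longrightarrow> (\<lambda>w. f w j) \<in> borel_measurable M"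
  shows "(\<lambda>w. amp (f w) J m n t) \<in> borel_measurable M"
proof -
  have [measurable]: "(\<lambda>w. hop (f w) J n k m) \<in> borel_measurable M" for k
    by (rule hop_measurable[OF assms])
  show ?thesis unfolding amp_def by measurable
qed

text \<open>Rational times keep the supremum measurable; the indicator confines the energies to
  \<open>\<bar>E\<bar> \<le> B + 2\<close>.\<close>

definition amp_sup :: "real \<Rightarrow> (int \<Rightarrow> real) \<Rightarrow> int set \<Rightarrow> int \<Rightarrow> int \<Rightarrow> ennreal" where
  "amp_sup B \<omega> J m n = (\<Prod>j\<in>J. indicator {-B..B} (\<omega> j)) * (SUP t\<in>\<rat>. ennreal (cmod (amp \<omega> J m n t)))"

lemma amp_sup_measurable:
  assumes "\<And>j. j \<in> J \<Longrightarrow> (\<lambda>w. f w j) \<in> borel_measurable M"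
  shows "(\<lambda>w. amp_sup B (f w) J m n) \<in> borel_measurable M"
proof -
  have [measurable]: "(\<lambda>w. amp (f w) J m n t) \<in> borel_measurable M" for t
    by (rule amp_measurable[OF assms])
  have [measurable]: "(\<lambda>w. indicator {-B..B} (f w j) :: ennreal) \<in> borel_measurable M" if "j \<in> J" for j
    using assms[OF that] by measurable
  have [measurable]: "(\<lambda>w. SUP t\<in>\<rat>. ennreal (cmod (amp (f w) J m n t))) \<in> borel_measurable M"
    by (rule borel_measurable_SUP) (auto simp: countable_rat)
  show ?thesis unfolding amp_sup_def by measurable
qed

lemma amp_spectral_middle:
  fixes m :: int and L d :: nat
  defines "N \<equiv> 2 * L + 1" and "J \<equiv> {m - int L - 1<..m + int L}"
  assumes d: "d \<le> L" and x: "x = (\<lambda>i. \<omega> (m - int L + int i))"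
  shows "amp \<omega> J m (m + int d) t
    = (\<Sum>E\<in>spec x N. exp (- (\<i> * complex_of_real t) * complex_of_real E) *
        complex_of_real (poly (jac x (Suc L)) E * poly (jac x (Suc L + d)) E / sqsum x N E))"
proof -
  have "amp \<omega> {m - int L - 1<..m - int L - 1 + int N} (m - int L - 1 + int (Suc L)) (m - int L - 1 + int (Suc L + d)) t
    = (\<Sum>E\<in>spec x N. exp (- (\<i> * complex_of_real t) * complex_of_real E) *
        complex_of_real (poly (jac x (Suc L)) E * poly (jac x (Suc L + d)) E / sqsum x N E))"
    by (rule amp_spectral) (use d in \<open>auto simp: N_def x algebra_simps\<close>)
  moreover have "m - int L - 1 + int N = m + int L" "m - int L - 1 + int (Suc L) = m"
    "m - int L - 1 + int (Suc L + d) = m + int d"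
    unfolding N_def by auto
  ultimately show ?thesis by (simp only: J_def)
qed

text \<open>The phases have modulus 1, which removes the time. Eigenfunctions vanishing at
  \<open>m\<close> contribute nothing, and dropping them leaves regular energies. Only entries of
  \<open>x\<close> and \<open>y\<close> below \<open>L\<close> are prescribed, so
  \<open>theta\<close> and \<open>g\<close> do not see the potential at \<open>m\<close>; only
  \<open>A\<close> moves with it.\<close>

lemma amp_sup_le:
  fixes m :: int and L d :: nat and x y :: "nat \<Rightarrow> real"
  defines "J \<equiv> {m - int L - 1<..m + int L}" and "g \<equiv> \<lambda>E. \<bar>poly (jac y (Suc L - d)) E / poly (jac y (Suc L)) E\<bar>"
  assumes d: "d \<le> L" and x: "\<And>i. i < L \<Longrightarrow> x i = \<omega> (m - int L + int i)"
    and y: "\<And>i. i < L \<Longrightarrow> y i = \<omega> (m + int L - int i)"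
  obtains A where "finite A" "\<And>E. E \<in> A \<Longrightarrow> regular x y L E \<and> \<bar>E\<bar> \<le> B + 2 \<and> theta x y L E = \<omega> m"
    "amp_sup B \<omega> J m (m + int d) \<le> ennreal (\<Sum>E\<in>A. g E / dtheta x y L E)"
proof (cases "\<forall>j\<in>J. \<bar>\<omega> j\<bar> \<le> B")
  case False
  have fJ: "finite J" by (simp add: J_def)
  obtain j where "j \<in> J" "\<not> \<bar>\<omega> j\<bar> \<le> B" using False by blast
  then have "(\<Prod>j\<in>J. indicator {-B..B} (\<omega> j)) = (0 :: ennreal)"
    using fJ by (intro prod_zero) (auto intro!: bexI[of _ j] simp: abs_le_iff)
  then have "amp_sup B \<omega> J m (m + int d) = 0"
    unfolding amp_sup_def by simp
  then show ?thesis by (intro that[of "{}"]) auto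
next
  case B: True
  define z where "z = (\<lambda>i. \<omega> (m - int L + int i))"
  define N where "N = 2 * L + 1"
  have jx: "jac x k = jac z k" if "k \<le> Suc L" for k
    using that by (intro jac_cong) (auto simp: z_def x)
  have jy: "jac y k = jac (\<lambda>i. z (2 * L - i)) k" if "k \<le> Suc L" for k
    using that by (intro jac_cong) (auto simp: z_def y of_nat_diff algebra_simps)
  define A where "A = {E \<in> spec z N. poly (jac z (Suc L)) E \<noteq> 0}"
  let ?c = "\<lambda>E. poly (jac z (Suc L)) E * poly (jac z (Suc L + d)) E / sqsum z N E"
  have sq: "sqsum x L E = sqsum z L E" "sqsum y L E = sqsum (\<lambda>i. z (2 * L - i)) L E" for E
    unfolding sqsum_def by (simp_all add: jx jy)
  have mid: "regular x y L E \<and> theta x y L E = \<omega> m \<and> \<bar>?c E\<bar> = g E / dtheta x y L E" if "E \<in> A" for E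
  proof -
    have 1: "E \<in> spec z (2 * L + 1)" "poly (jac z (Suc L)) E \<noteq> 0"
      using that by (auto simp: A_def N_def)
    have "z L = \<omega> m" by (simp add: z_def)
    then show ?thesis
      using eigenfunction_at_middle[OF 1 d]
      unfolding N_def g_def regular_def theta_def dtheta_def sq
      by (simp add: jx jy del: jac.simps)
  qed
  have le: "cmod (amp \<omega> J m (m + int d) t) \<le> (\<Sum>E\<in>A. g E / dtheta x y L E)" for t
  proof -
    have "cmod (amp \<omega> J m (m + int d) t) \<le> (\<Sum>E\<in>spec z N. \<bar>?c E\<bar>)"
      unfolding J_def amp_spectral_middle[OF d z_def] N_def
      by (rule order_trans[OF norm_sum]) (simp add: norm_mult norm_divide abs_mult del: jac.simps)
    also have "\<dots> = (\<Sum>E\<in>A. \<bar>?c E\<bar>)"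
      by (rule sum.mono_neutral_right) (auto simp: A_def finite_spec)
    also have "\<dots> = (\<Sum>E\<in>A. g E / dtheta x y L E)"
      using mid by (intro sum.cong) auto
    finally show ?thesis .
  qed
  show ?thesis
  proof (rule that[of A])
    show "finite A" by (simp add: A_def finite_spec)
    show "regular x y L E \<and> \<bar>E\<bar> \<le> B + 2 \<and> theta x y L E = \<omega> m" if "E \<in> A" for E
    proof -
      have "\<bar>E\<bar> \<le> B + 2"
        by (rule spec_bounded[of _ z N]) (use that B in \<open>auto simp: A_def z_def J_def N_def\<close>)
      then show ?thesis using mid[OF that] by blast
    qed
    have "amp_sup B \<omega> J m (m + int d) = (SUP t\<in>\<rat>. ennreal (cmod (amp \<omega> J m (m + int d) t)))"
      unfolding amp_sup_def using B by (simp add: abs_le_iff prod.neutral minus_le_iff)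
    also have "\<dots> \<le> ennreal (\<Sum>E\<in>A. g E / dtheta x y L E)"
      by (intro SUP_least ennreal_leI le)
    finally show "amp_sup B \<omega> J m (m + int d) \<le> ennreal (\<Sum>E\<in>A. g E / dtheta x y L E)" .
  qed
qed

context bounded_density
begin

lemma amp_sup_site_average_le:
  fixes V :: "int \<Rightarrow> real" and m :: int and L d :: nat
  defines "J \<equiv> {m - int L - 1<..m + int L}"
    and "x \<equiv> \<lambda>i. V (m - int L + int i)" and "y \<equiv> \<lambda>i. V (m + int L - int i)"
  assumes d: "d \<le> L"
  shows "(\<integral>\<^sup>+v. amp_sup B (V(m := v)) J m (m + int d) \<partial>\<nu>)
    \<le> (\<integral>\<^sup>+E. indicator {- (B + 2)..B + 2} E *
        ennreal (r (E - zeta E x L - zeta E y L) * (\<Prod>k\<in>{L - d<..L}. \<bar>zeta E y k\<bar>)) \<partial>lborel)"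
proof -
  define g where "g E = \<bar>poly (jac y (Suc L - d)) E / poly (jac y (Suc L)) E\<bar>" for E
  have "\<exists>A. finite A \<and> (\<forall>E\<in>A. regular x y L E \<and> \<bar>E\<bar> \<le> B + 2 \<and> theta x y L E = v) \<and>
      amp_sup B (V(m := v)) J m (m + int d) \<le> ennreal (\<Sum>E\<in>A. g E / dtheta x y L E)" for v
  proof -
    obtain A where "finite A"
      "\<And>E. E \<in> A \<Longrightarrow> regular x y L E \<and> \<bar>E\<bar> \<le> B + 2 \<and> theta x y L E = (V(m := v)) m"
      "amp_sup B (V(m := v)) J m (m + int d) \<le> ennreal (\<Sum>E\<in>A. g E / dtheta x y L E)"
      using amp_sup_le[OF d, of x "V(m := v)" m y B] unfolding J_def g_def
      by (force simp: x_def y_def)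
    then show ?thesis by auto
  qed
  then obtain A where A: "\<And>v. finite (A v)"
    "\<And>v E. E \<in> A v \<Longrightarrow> regular x y L E \<and> \<bar>E\<bar> \<le> B + 2 \<and> theta x y L E = v"
    "\<And>v. amp_sup B (V(m := v)) J m (m + int d) \<le> ennreal (\<Sum>E\<in>A v. g E / dtheta x y L E)"
    by metis
  have [measurable]: "(\<lambda>v. (V(m := v)) j) \<in> borel_measurable borel" for j
    by (cases "j = m") auto
  have meas[measurable]: "(\<lambda>v. amp_sup B (V(m := v)) J m (m + int d)) \<in> borel_measurable borel"
    by (rule amp_sup_measurable) measurable
  have [measurable]: "g \<in> borel_measurable borel"
    unfolding g_def[abs_def] by measurable
  have "(\<integral>\<^sup>+v. amp_sup B (V(m := v)) J m (m + int d) \<partial>\<nu>)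
      = (\<integral>\<^sup>+v. ennreal (r v) * amp_sup B (V(m := v)) J m (m + int d) \<partial>lborel)"
    by (rule nn_integral_\<nu>[OF meas])
  also have "\<dots> \<le> (\<integral>\<^sup>+E. indicator {- (B + 2)..B + 2} E * ennreal (r (theta x y L E) * g E) \<partial>lborel)"
  proof (rule spectral_averaging[of r g, OF _ _ _ r_nonneg _ A(1) A(2)])
    show "ennreal (r v) * amp_sup B (V(m := v)) J m (m + int d)
        \<le> ennreal (r v * (\<Sum>E\<in>A v. g E / dtheta x y L E))" for v
    proof -
      have "0 \<le> (\<Sum>E\<in>A v. g E / dtheta x y L E)"
        by (intro sum_nonneg divide_nonneg_nonneg order_trans[OF zero_le_one dtheta_ge_1]) (simp add: g_def)
      then show ?thesis
        using A(3)[of v] by (subst ennreal_mult) (auto intro: mult_left_mono r_nonneg)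
    qed
  qed (auto simp: g_def)
  also have "\<dots> = (\<integral>\<^sup>+E. indicator {- (B + 2)..B + 2} E *
        ennreal (r (E - zeta E x L - zeta E y L) * (\<Prod>k\<in>{L - d<..L}. \<bar>zeta E y k\<bar>)) \<partial>lborel)"
  proof (rule nn_integral_cong_AE)
    \<comment> \<open>Off this finite set no denominator vanishes, so \<open>zeta\<close> is the
      ratio of polynomials.\<close>
    let ?F = "\<Union>k\<le>L. {E. poly (jac x (Suc k)) E = 0} \<union> {E. poly (jac y (Suc k)) E = 0}"
    have "finite ?F" by (intro finite_UN_I finite_UnI poly_roots_finite jac_nonzero) auto
    then have "?F \<in> null_sets lborel" by (rule finite_imp_null_set_lborel)
    then have "AE E in lborel. E \<notin> ?F" by (rule AE_not_in)
    then show "AE E in lborel. indicator {- (B + 2)..B + 2} E * ennreal (r (theta x y L E) * g E)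
      = indicator {- (B + 2)..B + 2} E *
        ennreal (r (E - zeta E x L - zeta E y L) * (\<Prod>k\<in>{L - d<..L}. \<bar>zeta E y k\<bar>))"
    proof eventually_elim
      case (elim E)
      then have nz: "poly (jac x (Suc k)) E \<noteq> 0" "poly (jac y (Suc k)) E \<noteq> 0" if "k \<le> L" for k
        using that by auto
      have "theta x y L E = E - zeta E x L - zeta E y L"
        unfolding theta_def using nz by (simp add: zeta_jac del: jac.simps)
      moreover have "g E = (\<Prod>k\<in>{L - d<..L}. \<bar>zeta E y k\<bar>)"
        unfolding g_def by (rule prod_zeta_jac[symmetric]) (use nz d in auto)
      ultimately show ?case by simp
    qed
  qed
  finally show ?thesis .
qed

section \<open>Decay of the iterated transfer operator and the box estimate\<close>

text \<open>The root appears because the two-step contraction is stated for squared norms.\<close>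

definition rate :: "nat \<Rightarrow> real" where
  "rate N = sqrt (8 * (real N)\<^sup>2 / (1 + 8 * (real N)\<^sup>2))"

text \<open>The first \<open>d - 1\<close> steps are paired and contract in \<open>L^2\<close>; the
  last one is spent on passing to a pointwise bound. For \<open>d = 0\<close> truncated subtraction
  makes the exponent 0 and \<open>le\<close> suffices.\<close>

lemma transfer_iterate_le:
  assumes f[measurable]: "f \<in> borel_measurable borel" and nn: "\<And>x. 0 \<le> f x" and le: "\<And>x. f x \<le> M"
    and sq: "sqnorm f \<le> ennreal M" and N: "N > 0" "16 * M \<le> real N"
  shows "(transfer E ^^ d) f z \<le> M * rate N ^ ((d - 1) div 2)"
proof (cases d)
  case (Suc d')
  define q where "q = 8 * (real N)\<^sup>2 / (1 + 8 * (real N)\<^sup>2)"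
  have q: "0 \<le> q" "rate N = sqrt q" by (simp_all add: q_def rate_def)
  have fin: "sqnorm f < \<infinity>" using sq by (rule le_less_trans) simp
  define h where "h = (transfer E ^^ d') f"
  have h[measurable]: "h \<in> borel_measurable borel"
    unfolding h_def by (induction d') auto
  have hsq: "sqnorm h \<le> ennreal (q ^ (d' div 2)) * sqnorm f"
    unfolding h_def q_def by (rule sqnorm_iterate_le[OF f fin N])
  also have "\<dots> \<le> ennreal (q ^ (d' div 2)) * ennreal M"
    by (intro mult_left_mono sq) auto
  finally have hle: "sqnorm (invert h) \<le> ennreal (q ^ (d' div 2)) * ennreal M"
    using sqnorm_invert_le[OF h] by (rule order_trans[rotated])
  also have "\<dots> < \<infinity>" by (simp add: ennreal_mult_less_top)
  finally have "ennreal ((transfer E h z)\<^sup>2) \<le> ennreal M * sqnorm (invert h)"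
    unfolding transfer_def by (intro avg_square_le) auto
  also have "\<dots> \<le> ennreal M * (ennreal (q ^ (d' div 2)) * ennreal M)"
    by (intro mult_left_mono hle) auto
  also have "\<dots> = ennreal (M * (q ^ (d' div 2) * M))"
    using M_nonneg q by (simp add: ennreal_mult)
  also have "M * (q ^ (d' div 2) * M) = (M * rate N ^ (d' div 2))\<^sup>2"
    using q by (simp add: power_mult_distrib power2_eq_square) (simp add: power_mult_distrib[symmetric])
  finally have "(transfer E h z)\<^sup>2 \<le> (M * rate N ^ (d' div 2))\<^sup>2"
    by (simp add: ennreal_le_iff)
  then have "transfer E h z \<le> M * rate N ^ (d' div 2)"
    by (rule power2_le_imp_le) (use M_nonneg q in simp)
  then show ?thesis by (simp add: Suc h_def)
qed (simp add: le)

text \<open>From \<open>r^2 <= M * r\<close> and total mass 1.\<close>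

lemma sqnorm_reflect_r_le: "sqnorm (\<lambda>z. r (c - z)) \<le> ennreal M"
proof -
  have "sqnorm (\<lambda>z. r (c - z)) = (\<integral>\<^sup>+x. ennreal ((r x)\<^sup>2) \<partial>lborel)"
    unfolding sqnorm_def by (rule nn_integral_reflect) measurable
  also have "\<dots> \<le> (\<integral>\<^sup>+x. ennreal M * ennreal (r x) \<partial>lborel)"
    using r_nonneg r_le M_nonneg
    by (intro nn_integral_mono) (auto simp: power2_eq_square ennreal_mult[symmetric] intro!: ennreal_leI mult_right_mono)
  also have "\<dots> = ennreal M"
    by (subst nn_integral_cmult) (auto simp: nn_integral_r)
  finally show ?thesis .
qed

text \<open>After averaging over site \<open>m\<close> the left potentials only shift the argument
  of \<open>r\<close>. With them and the energy frozen, the right ones are integrated by the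
  transfer operator, uniformly in the shift. The factor \<open>2 * (B + 2)\<close> is the length of
  the energy window.\<close>

lemma expectation_amp_sup_le:
  fixes m :: int and L d :: nat
  defines "J \<equiv> {m - int L - 1<..m + int L}"
  assumes d: "d \<le> L" and B: "0 \<le> B" and N: "N > 0" "16 * M \<le> real N"
  shows "(\<integral>\<^sup>+\<omega>. amp_sup B \<omega> J m (m + int d) \<partial>(\<Pi>\<^sub>M j\<in>J. \<nu>))
    \<le> ennreal (2 * (B + 2) * (M * rate N ^ ((d - 1) div 2)))"
proof -
  define S where "S = M * rate N ^ ((d - 1) div 2)"
  have S: "0 \<le> S" using M_nonneg by (simp add: S_def rate_def)
  define Lf where "Lf = {m - int L - 1<..<m}"
  define Rt where "Rt = {m<..m + int L}"
  let ?x = "\<lambda>\<omega> i. \<omega> (m - int L + int i)" and ?y = "\<lambda>\<omega> i. \<omega> (m + int L - int i)"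
  define G where "G E \<omega> = ennreal (r (E - zeta E (?x \<omega>) L - zeta E (?y \<omega>) L) *
      (\<Prod>k\<in>{L - d<..L}. \<bar>zeta E (?y \<omega>) k\<bar>))" for E \<omega>
  have J: "J = insert m (Lf \<union> Rt)" "finite (Lf \<union> Rt)" "m \<notin> Lf \<union> Rt" "Lf \<inter> Rt = {}" "finite Lf" "finite Rt"
    by (auto simp: J_def Lf_def Rt_def)
  interpret PI: prob_space "\<Pi>\<^sub>M j\<in>Lf \<union> Rt. \<nu>" by (intro prob_space_PiM \<nu>.prob_space_axioms)
  interpret PL: prob_space "\<Pi>\<^sub>M j\<in>Lf. \<nu>" by (intro prob_space_PiM \<nu>.prob_space_axioms)
  interpret F: pair_sigma_finite lborel "\<Pi>\<^sub>M j\<in>Lf \<union> Rt. \<nu>" ..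
  have xi: "m - int L + int i \<in> Lf" if "i < L" for i using that by (auto simp: Lf_def)
  have yi: "m + int L - int i \<in> Rt" if "i < L" for i using that by (auto simp: Rt_def)
  \<comment> \<open>The general form covers measurability in the potentials alone and jointly with
    the energy, as Fubini requires.\<close>
  have Gm[measurable]: "(\<lambda>w. G (f w) (h w)) \<in> borel_measurable K"
    if [measurable]: "f \<in> borel_measurable K" and h: "h \<in> measurable K (\<Pi>\<^sub>M j\<in>Lf \<union> Rt. \<nu>)" for f h K
  proof -
    have comp: "(\<lambda>w. h w j) \<in> borel_measurable K" if "j \<in> Lf \<union> Rt" for j
      using measurable_compose[OF h measurable_component_singleton[OF that]]
      by (simp add: measurable_cong_sets[OF refl sets_\<nu>])
    have [measurable]: "(\<lambda>w. zeta (f w) (?x (h w)) L) \<in> borel_measurable K"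
      by (rule zeta_measurable) (auto intro!: comp simp: xi)
    have [measurable]: "(\<lambda>w. zeta (f w) (?y (h w)) k) \<in> borel_measurable K" if "k \<le> L" for k
      using that by (intro zeta_measurable) (auto intro!: comp simp: yi)
    have [measurable]: "(\<lambda>w. zeta (f w) (?y (h w)) k) \<in> borel_measurable K" if "k \<in> {L - d<..L}" for k
      using that by simp
    have [measurable]: "(\<lambda>w. zeta (f w) (?y (h w)) L) \<in> borel_measurable K" by simp
    show ?thesis unfolding G_def by measurable
  qed
  have GI: "(\<integral>\<^sup>+\<omega>. G E \<omega> \<partial>(\<Pi>\<^sub>M j\<in>Lf \<union> Rt. \<nu>)) \<le> ennreal S" for E
  proof -
    have "(\<integral>\<^sup>+\<omega>. G E \<omega> \<partial>(\<Pi>\<^sub>M j\<in>Lf \<union> Rt. \<nu>))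
        = (\<integral>\<^sup>+u. \<integral>\<^sup>+w. G E (merge Lf Rt (u, w)) \<partial>(\<Pi>\<^sub>M j\<in>Rt. \<nu>) \<partial>(\<Pi>\<^sub>M j\<in>Lf. \<nu>))"
      using J by (intro P.product_nn_integral_fold) auto
    also have "\<dots> \<le> (\<integral>\<^sup>+u. ennreal S \<partial>(\<Pi>\<^sub>M j\<in>Lf. \<nu>))"
    proof (rule nn_integral_mono)
      fix u
      let ?f = "\<lambda>z. r (E - zeta E (?x u) L - z)"
      have zx: "zeta E (?x (merge Lf Rt (u, w))) L = zeta E (?x u) L" for w
        using xi J(4) by (intro zeta_cong) (simp add: merge_def)
      have zy: "zeta E (?y (merge Lf Rt (u, w))) k = zeta E (?y w) k" if "k \<le> L" for w k
        using yi J(4) that by (intro zeta_cong) (auto simp add: merge_def)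
      have "(\<integral>\<^sup>+w. G E (merge Lf Rt (u, w)) \<partial>(\<Pi>\<^sub>M j\<in>Rt. \<nu>))
        = (\<integral>\<^sup>+w. ennreal (?f (zeta E (?y w) L) * (\<Prod>k\<in>{L - d<..L}. \<bar>zeta E (?y w) k\<bar>)) \<partial>(\<Pi>\<^sub>M j\<in>Rt. \<nu>))"
        unfolding G_def zx by (intro nn_integral_cong) (simp add: zy)
      also have "\<dots> = (\<integral>\<^sup>+w. ennreal (?f (zeta E (?y w) L) * (\<Prod>k\<in>{L - d<..L}. \<bar>zeta E (?y w) k\<bar>))
          \<partial>(\<Pi>\<^sub>M j\<in>{m + int L - int L<..m + int L}. \<nu>))"
        by (simp add: Rt_def)
      also have "\<dots> \<le> ennreal S"
      proof (rule expectation_zeta_prod_le[where f = ?f])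
        show "sqnorm ?f < \<infinity>"
          using sqnorm_reflect_r_le by (rule le_less_trans) simp
        show "(transfer E ^^ d) ?f z \<le> S" for z
          unfolding S_def by (rule transfer_iterate_le) (auto simp: r_nonneg r_le N sqnorm_reflect_r_le)
      qed (auto simp: r_nonneg d)
      finally show "(\<integral>\<^sup>+w. G E (merge Lf Rt (u, w)) \<partial>(\<Pi>\<^sub>M j\<in>Rt. \<nu>)) \<le> ennreal S" .
    qed
    also have "\<dots> = ennreal S" by (simp add: PL.emeasure_space_1)
    finally show ?thesis .
  qed
  have "(\<integral>\<^sup>+\<omega>. amp_sup B \<omega> J m (m + int d) \<partial>(\<Pi>\<^sub>M j\<in>J. \<nu>))
      = (\<integral>\<^sup>+V. \<integral>\<^sup>+v. amp_sup B (V(m := v)) J m (m + int d) \<partial>\<nu> \<partial>(\<Pi>\<^sub>M j\<in>Lf \<union> Rt. \<nu>))"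
  proof -
    have "(\<lambda>\<omega>. amp_sup B \<omega> J m (m + int d)) \<in> borel_measurable (\<Pi>\<^sub>M j\<in>J. \<nu>)"
      by (rule amp_sup_measurable) measurable
    then show ?thesis
      using J by (subst (1) J(1), intro P.product_nn_integral_insert) auto
  qed
  also have "\<dots> \<le> (\<integral>\<^sup>+\<omega>. \<integral>\<^sup>+E. indicator {- (B + 2)..B + 2} E * G E \<omega> \<partial>lborel \<partial>(\<Pi>\<^sub>M j\<in>Lf \<union> Rt. \<nu>))"
    unfolding J_def G_def by (intro nn_integral_mono amp_sup_site_average_le d)
  also have "\<dots> = (\<integral>\<^sup>+E. \<integral>\<^sup>+\<omega>. indicator {- (B + 2)..B + 2} E * G E \<omega> \<partial>(\<Pi>\<^sub>M j\<in>Lf \<union> Rt. \<nu>) \<partial>lborel)"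
    by (rule F.Fubini') measurable
  also have "\<dots> = (\<integral>\<^sup>+E. indicator {- (B + 2)..B + 2} E * (\<integral>\<^sup>+\<omega>. G E \<omega> \<partial>(\<Pi>\<^sub>M j\<in>Lf \<union> Rt. \<nu>)) \<partial>lborel)"
    by (intro nn_integral_cong nn_integral_cmult) measurable
  also have "\<dots> \<le> (\<integral>\<^sup>+E. indicator {- (B + 2)..B + 2} E * ennreal S \<partial>lborel)"
    by (intro nn_integral_mono mult_left_mono GI) auto
  also have "\<dots> = (\<integral>\<^sup>+E. indicator {- (B + 2)..B + 2} E \<partial>lborel) * ennreal S"
    by (rule nn_integral_multc) measurable
  also have "(\<integral>\<^sup>+E. indicator {- (B + 2)..B + 2} E \<partial>lborel) = emeasure lborel {- (B + 2)..B + 2}"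
    by simp
  also have "\<dots> = ennreal (2 * (B + 2))"
    using B by (subst emeasure_lborel_Icc) (auto intro: arg_cong[of _ _ ennreal])
  also have "ennreal (2 * (B + 2)) * ennreal S = ennreal (2 * (B + 2) * S)"
    using B S by (intro ennreal_mult[symmetric]) auto
  finally show ?thesis by (simp add: S_def)
qed

end

section \<open>The infinite-volume limit\<close>

lemma hop_cong: "(\<And>j. j \<in> J \<Longrightarrow> \<omega> j = \<omega>' j) \<Longrightarrow> hop \<omega> J n k j = hop \<omega>' J n k j"
  by (induction k arbitrary: j) auto

lemma amp_sup_cong: "(\<And>j. j \<in> J \<Longrightarrow> \<omega> j = \<omega>' j) \<Longrightarrow> amp_sup B \<omega> J m n = amp_sup B \<omega>' J m n"
  unfolding amp_sup_def amp_def by (simp cong: hop_cong)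

lemma hop_bound:
  assumes "\<And>j. \<bar>\<omega> j\<bar> \<le> B"
  shows "\<bar>hop \<omega> J n k j\<bar> \<le> (B + 2) ^ k"
proof (induction k arbitrary: j)
  case (Suc k)
  have B: "0 \<le> B" using assms[of 0] by linarith
  show ?case
  proof (cases "j \<in> J")
    case True
    have "\<bar>\<omega> j * hop \<omega> J n k j\<bar> \<le> B * (B + 2) ^ k"
      unfolding abs_mult using B by (intro mult_mono assms Suc.IH) auto
    then show ?thesis
      using Suc.IH[of "j + 1"] Suc.IH[of "j - 1"] True by (simp add: algebra_simps)
  qed (use B in auto)
qed auto

lemma hop_outside: "j < n - int k \<or> j > n + int k \<Longrightarrow> hop \<omega> J n k j = 0"
  by (induction k arbitrary: j) auto

text \<open>Finite propagation: \<open>k\<close> hops from \<open>n\<close> stay within distance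
  \<open>k\<close> and so never notice the boundary.\<close>

lemma hop_eq_UNIV:
  assumes "{n - int k..n + int k} \<subseteq> J"
  shows "hop \<omega> J n k j = hop \<omega> UNIV n k j"
  using assms
proof (induction k arbitrary: j)
  case (Suc k)
  have IH: "hop \<omega> J n k i = hop \<omega> UNIV n k i" for i
    by (rule Suc.IH) (use Suc.prems in \<open>auto simp: subset_iff\<close>)
  show ?case
  proof (cases "j \<in> J")
    case False
    then have "j \<notin> {n - int (Suc k)..n + int (Suc k)}" using Suc.prems by blast
    then have "j < n - int (Suc k) \<or> j > n + int (Suc k)" by auto
    then have "hop \<omega> UNIV n (Suc k) j = 0" by (rule hop_outside)
    then show ?thesis using False by simp
  qed (simp add: IH)
qed simp

text \<open>\<open>hop\<close> recurses on the target site; the matching recursion on the source is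
  what the proof of symmetry needs.\<close>

lemma hop_UNIV_Suc_source:
  "hop \<omega> UNIV n (Suc k) j = hop \<omega> UNIV (n + 1) k j + hop \<omega> UNIV (n - 1) k j + \<omega> n * hop \<omega> UNIV n k j"
proof (induction k arbitrary: j)
  case (Suc k)
  have "hop \<omega> UNIV n (Suc (Suc k)) j = hop \<omega> UNIV n (Suc k) (j + 1) + hop \<omega> UNIV n (Suc k) (j - 1)
      + \<omega> j * hop \<omega> UNIV n (Suc k) j"
    by simp
  also have "\<dots> = hop \<omega> UNIV (n + 1) (Suc k) j + hop \<omega> UNIV (n - 1) (Suc k) j + \<omega> n * hop \<omega> UNIV n (Suc k) j"
  proof -
    have "\<omega> j * hop \<omega> UNIV n (Suc k) j
        = \<omega> j * (hop \<omega> UNIV (n + 1) k j + hop \<omega> UNIV (n - 1) k j + \<omega> n * hop \<omega> UNIV n k j)"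
      by (simp only: Suc.IH)
    moreover have "\<omega> n * hop \<omega> UNIV n (Suc k) j
        = \<omega> n * (hop \<omega> UNIV n k (j + 1) + hop \<omega> UNIV n k (j - 1) + \<omega> j * hop \<omega> UNIV n k j)"
      by simp
    ultimately show ?thesis
      using Suc.IH[of "j + 1"] Suc.IH[of "j - 1"] by (simp add: algebra_simps)
  qed
  finally show ?case .
qed auto

lemma hop_UNIV_commute: "hop \<omega> UNIV n k m = hop \<omega> UNIV m k n"
proof (induction k arbitrary: n m)
  case (Suc k)
  have "hop \<omega> UNIV n (Suc k) m = hop \<omega> UNIV m k (n + 1) + hop \<omega> UNIV m k (n - 1) + \<omega> n * hop \<omega> UNIV m k n"
    unfolding hop_UNIV_Suc_source using Suc.IH[of _ m] by simp
  then show ?case by simp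
qed auto

lemma amp_UNIV_commute: "amp \<omega> UNIV m n t = amp \<omega> UNIV n m t"
  unfolding amp_def by (subst hop_UNIV_commute) simp

text \<open>Each term of the series is eventually constant in \<open>L\<close>, and
  \<open>hop_bound\<close> gives an exponential majorant independent of the box.\<close>

lemma amp_tendsto:
  assumes B: "\<And>j. \<bar>\<omega> j\<bar> \<le> B"
  shows "(\<lambda>L. amp \<omega> {m - int L - 1<..m + int L} m n t) \<longlonglongrightarrow> amp \<omega> UNIV m n t"
proof -
  let ?f = "\<lambda>k L. ((- (\<i> * complex_of_real t)) ^ k /\<^sub>R fact k) * complex_of_real (hop \<omega> {m - int L - 1<..m + int L} n k m)"
  let ?g = "\<lambda>k. ((- (\<i> * complex_of_real t)) ^ k /\<^sub>R fact k) * complex_of_real (hop \<omega> UNIV n k m)"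
  let ?M = "\<lambda>k. (\<bar>t\<bar> * (B + 2)) ^ k /\<^sub>R fact k"
  have "(\<forall>\<^sub>F L in sequentially. summable (\<lambda>k. norm (?f k L))) \<and> summable (\<lambda>k. norm (?g k)) \<and>
      (\<lambda>L. suminf (\<lambda>k. ?f k L)) \<longlonglongrightarrow> suminf ?g"
  proof (rule tannerys_theorem[where M = ?M])
    show "((\<lambda>L. ?f k L) \<longlonglongrightarrow> ?g k)" for k
    proof (rule tendsto_eventually)
      have "hop \<omega> {m - int L - 1<..m + int L} n k m = hop \<omega> UNIV n k m" if "L \<ge> nat (\<bar>m - n\<bar> + int k)" for L
        using that by (intro hop_eq_UNIV) auto
      then show "\<forall>\<^sub>F L in sequentially. ?f k L = ?g k"
        by (intro eventually_sequentiallyI[of "nat (\<bar>m - n\<bar> + int k)"]) simp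
    qed
    have "norm (?f k L) \<le> ?M k" for k L
    proof -
      have "norm (?f k L) = (\<bar>t\<bar> ^ k / fact k) * \<bar>hop \<omega> {m - int L - 1<..m + int L} n k m\<bar>"
        by (simp add: norm_mult norm_power divide_inverse mult_ac)
      also have "\<dots> \<le> (\<bar>t\<bar> ^ k / fact k) * (B + 2) ^ k"
        by (intro mult_left_mono hop_bound B) auto
      finally show ?thesis by (simp add: power_mult_distrib divide_inverse mult_ac)
    qed
    then show "\<forall>\<^sub>F (k, L) in at_top \<times>\<^sub>F sequentially. norm (?f k L) \<le> ?M k"
      by (intro always_eventually) auto
    show "summable ?M" by (rule summable_exp_generic)
  qed auto
  then show ?thesis unfolding amp_def by blast
qed

lemma amp_le_amp_sup:
  fixes m :: int and L d :: nat
  defines "J \<equiv> {m - int L - 1<..m + int L}"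
  assumes B: "\<And>j. \<bar>\<omega> j\<bar> \<le> B" and d: "d \<le> L"
  shows "ennreal (cmod (amp \<omega> J m (m + int d) t)) \<le> amp_sup B \<omega> J m (m + int d)"
proof -
  let ?X = "SUP t\<in>\<rat>. ennreal (cmod (amp \<omega> J m (m + int d) t))"
  have "continuous_on UNIV (\<lambda>t. amp \<omega> J m (m + int d) t)"
    unfolding J_def amp_spectral_middle[OF d refl] by (intro continuous_intros)
  then have "closed {t. ennreal (cmod (amp \<omega> J m (m + int d) t)) \<le> ?X}"
    by (intro closed_Collect_le continuous_on_ennreal continuous_intros)
  moreover have "\<rat> \<subseteq> {t. ennreal (cmod (amp \<omega> J m (m + int d) t)) \<le> ?X}"
    by (auto intro: SUP_upper)
  ultimately have "ennreal (cmod (amp \<omega> J m (m + int d) t)) \<le> ?X"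
    using closure_minimal Rats_closure_real by blast
  also have "?X = amp_sup B \<omega> J m (m + int d)"
    unfolding amp_sup_def using B by (simp add: abs_le_iff prod.neutral minus_le_iff)
  finally show ?thesis .
qed

text \<open>The right side does not contain \<open>t\<close>, so it dominates the supremum over all
  real times by one measurable function.\<close>

lemma amp_UNIV_le_liminf:
  assumes B: "\<And>j. \<bar>\<omega> j\<bar> \<le> B"
  shows "ennreal (cmod (amp \<omega> UNIV m (m + int d) t))
    \<le> liminf (\<lambda>L. amp_sup B \<omega> {m - int L - 1<..m + int L} m (m + int d))"
proof -
  have "(\<lambda>L. ennreal (cmod (amp \<omega> {m - int L - 1<..m + int L} m (m + int d) t)))
      \<longlonglongrightarrow> ennreal (cmod (amp \<omega> UNIV m (m + int d) t))"
    by (intro tendsto_ennrealI tendsto_norm amp_tendsto[OF B])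
  then have "ennreal (cmod (amp \<omega> UNIV m (m + int d) t))
      = liminf (\<lambda>L. ennreal (cmod (amp \<omega> {m - int L - 1<..m + int L} m (m + int d) t)))"
    by (intro lim_imp_Liminf[symmetric]) auto
  also have "\<dots> \<le> liminf (\<lambda>L. amp_sup B \<omega> {m - int L - 1<..m + int L} m (m + int d))"
    by (intro Liminf_mono eventually_sequentiallyI[of d] amp_le_amp_sup[OF B])
  finally show ?thesis .
qed

section \<open>Matrix elements of the evolution on the line\<close>

lemma cinner_basis_vec: "cinner (\<delta> m) f = coord f m"
proof -
  have "cinner (\<delta> m) f = infsum (\<lambda>n. coord f m) {m}"
    unfolding cinner_def by (rule infsum_cong_neutral) (auto simp: basis_vec.rep_eq)
  then show ?thesis by simp
qed

lemma coord_scaleR: "coord (c *\<^sub>R f) n = c *\<^sub>R coord f n"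
  by (simp add: scaleR_ell2_def scaleC.rep_eq scaleR_conv_of_real)

lemma bounded_linear_coord: "bounded_linear (\<lambda>f. coord f n)"
  by (rule bounded_linear_intro[where K = 1])
     (auto simp: plus_ell2.rep_eq coord_scaleR coord_le_norm)

lemma cinner_evolution:
  assumes B: "\<And>j. \<bar>\<omega> j\<bar> \<le> B"
  shows "cinner (\<delta> m) (evolution \<omega> t (\<delta> n)) = amp \<omega> UNIV m n t"
proof -
  let ?z = "- (\<i> * complex_of_real t)"
  define A where "A = scaleC_op ?z o\<^sub>L schroedinger \<omega>"
  have pow: "coord (blinfun_pow A k (\<delta> n)) j = ?z ^ k * complex_of_real (hop \<omega> UNIV n k j)" for k j
  proof (induction k arbitrary: j)
    case 0
    then show ?case by (simp add: blinfun_pow_def basis_vec.rep_eq)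
  next
    case (Suc k)
    have "blinfun_pow A (Suc k) (\<delta> n) = scaleC ?z (schroedinger \<omega> (blinfun_pow A k (\<delta> n)))"
      by (simp add: blinfun_pow_def A_def)
    then show ?case
      by (simp add: scaleC.rep_eq coord_schroedinger[OF B] Suc.IH algebra_simps)
  qed
  have "bounded_linear (\<lambda>T :: ell2 \<Rightarrow>\<^sub>L ell2. coord (T (\<delta> n)) m)"
    by (rule bounded_linear_compose[OF bounded_linear_coord blinfun.bounded_linear_left])
  from bounded_linear.suminf[OF this exp_op_summable[of A]]
  have "coord (exp_op A (\<delta> n)) m = (\<Sum>k. coord ((blinfun_pow A k /\<^sub>R fact k) (\<delta> n)) m)"
    by (simp add: exp_op_def)
  also have "\<dots> = amp \<omega> UNIV m n t"
    unfolding amp_def by (simp add: blinfun.scaleR_left coord_scaleR pow)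
  finally show ?thesis by (simp add: cinner_basis_vec evolution_def A_def)
qed

section \<open>Passage to the infinite volume and the final constants\<close>

context bounded_density
begin

text \<open>Fatou's lemma; each box quantity depends on finitely many sites, so its mean is taken in
  the finite product, where the bound is uniform in \<open>L\<close>.\<close>

lemma expectation_liminf_le:
  assumes B: "0 \<le> B" and N: "N > 0" "16 * M \<le> real N"
  shows "(\<integral>\<^sup>+\<omega>. liminf (\<lambda>L. amp_sup B \<omega> {m - int L - 1<..m + int L} m (m + int d)) \<partial>(\<Pi>\<^sub>M j\<in>UNIV. \<nu>))
    \<le> ennreal (2 * (B + 2) * (M * rate N ^ ((d - 1) div 2)))" (is "_ \<le> ?R")
proof -
  let ?J = "\<lambda>L. {m - int L - 1<..m + int L}"
  have meas: "(\<lambda>\<omega>. amp_sup B \<omega> J m (m + int d)) \<in> borel_measurable (\<Pi>\<^sub>M j\<in>I. \<nu>)" if "J \<subseteq> I" for J I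
    using that by (intro amp_sup_measurable) auto
  have "(\<integral>\<^sup>+\<omega>. liminf (\<lambda>L. amp_sup B \<omega> (?J L) m (m + int d)) \<partial>(\<Pi>\<^sub>M j\<in>UNIV. \<nu>))
      \<le> liminf (\<lambda>L. \<integral>\<^sup>+\<omega>. amp_sup B \<omega> (?J L) m (m + int d) \<partial>(\<Pi>\<^sub>M j\<in>UNIV. \<nu>))"
    by (intro nn_integral_liminf meas) simp
  also have "\<dots> \<le> liminf (\<lambda>L :: nat. ?R)"
  proof (intro Liminf_mono eventually_sequentiallyI[of d])
    fix L assume "d \<le> L"
    have "(\<integral>\<^sup>+\<omega>. amp_sup B \<omega> (?J L) m (m + int d) \<partial>(\<Pi>\<^sub>M j\<in>UNIV. \<nu>))
        = (\<integral>\<^sup>+\<omega>. amp_sup B (restrict \<omega> (?J L)) (?J L) m (m + int d) \<partial>(\<Pi>\<^sub>M j\<in>UNIV. \<nu>))"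
      by (intro nn_integral_cong amp_sup_cong) simp
    also have "\<dots> = (\<integral>\<^sup>+\<omega>. amp_sup B \<omega> (?J L) m (m + int d)
        \<partial>(distr (\<Pi>\<^sub>M j\<in>UNIV. \<nu>) (\<Pi>\<^sub>M j\<in>?J L. \<nu>) (\<lambda>\<omega>. restrict \<omega> (?J L))))"
      by (subst nn_integral_distr) (auto intro!: meas measurable_restrict_subset)
    also have "distr (\<Pi>\<^sub>M j\<in>UNIV. \<nu>) (\<Pi>\<^sub>M j\<in>?J L. \<nu>) (\<lambda>\<omega>. restrict \<omega> (?J L)) = (\<Pi>\<^sub>M j\<in>?J L. \<nu>)"
      by (rule P.distr_PiM_restrict_finite) auto
    finally show "(\<integral>\<^sup>+\<omega>. amp_sup B \<omega> (?J L) m (m + int d) \<partial>(\<Pi>\<^sub>M j\<in>UNIV. \<nu>)) \<le> ?R"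
      using expectation_amp_sup_le[OF \<open>d \<le> L\<close> B N] by simp
  qed
  also have "\<dots> = ?R" by (simp add: Liminf_const)
  finally show ?thesis .
qed

lemma rate_pos: "N > 0 \<Longrightarrow> 0 < rate N" and rate_less_1: "rate N < 1"
proof -
  show "0 < rate N" if "N > 0" unfolding rate_def using that
    by (intro real_sqrt_gt_zero divide_pos_pos add_pos_nonneg) auto
  have "8 * (real N)\<^sup>2 / (1 + 8 * (real N)\<^sup>2) < 1" by (simp add: add_pos_nonneg)
  then show "rate N < 1" unfolding rate_def by simp
qed

text \<open>From \<open>d <= 2 * Suc ((d - 1) div 2)\<close>; the surplus factor accounts for the
  division by \<open>rate N\<close>.\<close>

lemma rate_power_le:
  assumes N: "N > 0"
  shows "rate N ^ ((d - 1) div 2) \<le> exp (- (- ln (rate N) / 2) * real d) / rate N"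
proof -
  let ?p = "(d - 1) div 2"
  have "d \<le> 2 * Suc ?p" by presburger
  then have "real d \<le> real (2 * Suc ?p)" by (simp only: of_nat_le_iff)
  then have "real d \<le> 2 * real (Suc ?p)" by simp
  moreover have "0 \<le> - ln (rate N)" using rate_pos[OF N] rate_less_1[of N] by simp
  ultimately have "- ln (rate N) / 2 * real d \<le> - ln (rate N) / 2 * (2 * real (Suc ?p))"
    by (intro mult_left_mono) auto
  then have "real (Suc ?p) * ln (rate N) \<le> - (- ln (rate N) / 2) * real d"
    by (simp add: algebra_simps)
  then have "exp (real (Suc ?p) * ln (rate N)) \<le> exp (- (- ln (rate N) / 2) * real d)"
    by simp
  also have "exp (real (Suc ?p) * ln (rate N)) = rate N ^ Suc ?p"
    by (subst exp_of_nat_mult) (simp add: rate_pos[OF N])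
  finally show ?thesis using rate_pos[OF N] by (simp add: field_simps)
qed

end

theorem theorem4p1:
  fixes \<nu> :: "real measure" and r :: "real \<Rightarrow> real"
    and \<Omega> :: "(int \<Rightarrow> real) set" and \<mu> :: "(int \<Rightarrow> real) measure"
  assumes "prob_space \<nu>"
    and "r \<in> borel_measurable borel"
    and "\<And>E. 0 \<le> r E"
    and "bounded (range r)"
    and "compact (closure {E. r E \<noteq> 0})"
    and "\<nu> = density lborel (\<lambda>E. ennreal (r E))"
    and "\<Omega> = (\<Pi>\<^sub>E n\<in>UNIV. measure_support \<nu>)"
    and "\<mu> = (\<Pi>\<^sub>M n\<in>UNIV. \<nu>)"
  shows "\<exists>C \<gamma> :: real. C > 0 \<and> \<gamma> > 0 \<and>
    (\<forall>m n :: int.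
      (\<integral>\<^sup>+\<omega>\<in>\<Omega>. (SUP t :: real. ennreal (cmod (cinner (\<delta> m) (evolution \<omega> t (\<delta> n))))) \<partial>\<mu>)
        \<le> ennreal (C * exp (- \<gamma> * \<bar>real_of_int (m - n)\<bar>)))"
proof -
  obtain M where M: "\<And>E. r E \<le> M"
    using assms(4) unfolding bounded_iff by (metis abs_le_D1 rangeI real_norm_def)
  have [measurable]: "r \<in> borel_measurable borel" by fact
  have "(\<integral>\<^sup>+E. ennreal (r E) \<partial>lborel) = emeasure \<nu> (space \<nu>)"
    by (simp add: assms(6) emeasure_density)
  also have "\<dots> = 1" by (rule prob_space.emeasure_space_1[OF assms(1)])
  finally interpret D: bounded_density r M
    by unfold_locales (use assms M in auto)
  have \<nu>: "D.\<nu> = \<nu>" by (simp add: D.\<nu>_def assms(6))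
  obtain B0 where B0: "\<And>E. E \<in> closure {E. r E \<noteq> 0} \<Longrightarrow> \<bar>E\<bar> \<le> B0"
    using compact_imp_bounded[OF assms(5)] unfolding bounded_iff by auto
  define B where "B = max B0 0"
  have B: "0 \<le> B" by (simp add: B_def)
  have \<omega>_le: "\<bar>\<omega> j\<bar> \<le> B" if "\<omega> \<in> \<Omega>" for \<omega> j
  proof -
    have "\<omega> j \<in> measure_support \<nu>" using that unfolding assms(7) by auto
    then have "\<omega> j \<in> closure {E. r E \<noteq> 0}"
      using measure_support_density_subset[of r] assms(6) by auto
    from B0[OF this] show ?thesis by (simp add: B_def)
  qed
  obtain N where "max (16 * M) 1 < real N"
    using reals_Archimedean2 by blast
  then have N: "N > 0" "16 * M \<le> real N" by auto
  \<comment> \<open>Halved because one factor \<open>rate N\<close> is gained per two sites. In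
    \<open>C\<close> below, the added 1 makes positivity immediate.\<close>
  define \<gamma> where "\<gamma> = - ln (D.rate N) / 2"
  define C where "C = 2 * (B + 2) * M / D.rate N + 1"
  have rate: "0 < D.rate N" "D.rate N < 1" by (rule D.rate_pos[OF N(1)], rule D.rate_less_1)
  have "0 < C" unfolding C_def using B D.M_nonneg rate by (intro add_nonneg_pos divide_nonneg_pos mult_nonneg_nonneg) auto
  moreover have "0 < \<gamma>" unfolding \<gamma>_def using rate by simp
  moreover have decay: "(\<integral>\<^sup>+\<omega>\<in>\<Omega>. (SUP t :: real. ennreal (cmod (amp \<omega> UNIV m (m + int d) t))) \<partial>\<mu>)
      \<le> ennreal (C * exp (- \<gamma> * real d))" for m d
  proof -
    have "(\<integral>\<^sup>+\<omega>\<in>\<Omega>. (SUP t :: real. ennreal (cmod (amp \<omega> UNIV m (m + int d) t))) \<partial>\<mu>)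
        \<le> (\<integral>\<^sup>+\<omega>. liminf (\<lambda>L. amp_sup B \<omega> {m - int L - 1<..m + int L} m (m + int d)) \<partial>\<mu>)"
      \<comment> \<open>Outside \<open>\<Omega>\<close> the left integrand is 0; inside, the
        potential is bounded by \<open>B\<close>.\<close>
      by (intro nn_integral_mono) (auto simp: indicator_def intro!: SUP_least amp_UNIV_le_liminf \<omega>_le)
    also have "\<dots> \<le> ennreal (2 * (B + 2) * (M * D.rate N ^ ((d - 1) div 2)))"
      using D.expectation_liminf_le[OF B N] unfolding \<nu> assms(8) .
    also have "\<dots> \<le> ennreal (C * exp (- \<gamma> * real d))"
    proof (rule ennreal_leI)
      have "2 * (B + 2) * (M * D.rate N ^ ((d - 1) div 2))
          \<le> 2 * (B + 2) * (M * (exp (- \<gamma> * real d) / D.rate N))"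
        using D.rate_power_le[OF N(1), of d] B D.M_nonneg unfolding \<gamma>_def
        by (intro mult_left_mono) auto
      also have "\<dots> = (C - 1) * exp (- \<gamma> * real d)" by (simp add: C_def)
      also have "\<dots> \<le> C * exp (- \<gamma> * real d)" by (intro mult_right_mono) auto
      finally show "2 * (B + 2) * (M * D.rate N ^ ((d - 1) div 2)) \<le> C * exp (- \<gamma> * real d)" .
    qed
    finally show ?thesis .
  qed
  have "(\<integral>\<^sup>+\<omega>\<in>\<Omega>. (SUP t :: real. ennreal (cmod (cinner (\<delta> m) (evolution \<omega> t (\<delta> n))))) \<partial>\<mu>)
      \<le> ennreal (C * exp (- \<gamma> * \<bar>real_of_int (m - n)\<bar>))" for m n
  proof -
    have "cinner (\<delta> m) (evolution \<omega> t (\<delta> n)) = amp \<omega> UNIV m n t" if "\<omega> \<in> \<Omega>" for \<omega> t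
      by (rule cinner_evolution) (rule \<omega>_le[OF that])
    then have eq: "(\<integral>\<^sup>+\<omega>\<in>\<Omega>. (SUP t :: real. ennreal (cmod (cinner (\<delta> m) (evolution \<omega> t (\<delta> n))))) \<partial>\<mu>)
        = (\<integral>\<^sup>+\<omega>\<in>\<Omega>. (SUP t :: real. ennreal (cmod (amp \<omega> UNIV m n t))) \<partial>\<mu>)"
      by (intro nn_integral_cong) (auto simp: indicator_def)
    show ?thesis
    \<comment> \<open>The box estimate is for a target to the right of the centre; the other case is
      reduced to it by symmetry of the amplitude.\<close>
    proof (cases "m \<le> n")
      case True
      then have "n = m + int (nat (n - m))" "\<bar>real_of_int (m - n)\<bar> = real (nat (n - m))" by auto
      then show ?thesis unfolding eq using decay[of m "nat (n - m)"] by simp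
    next
      case False
      then have "m = n + int (nat (m - n))" "\<bar>real_of_int (m - n)\<bar> = real (nat (m - n))" by auto
      then show ?thesis unfolding eq amp_UNIV_commute[of _ m n] using decay[of n "nat (m - n)"] by simp
    qed
  qed
  ultimately show ?thesis by blast
qed

end
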